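(* Let $\mathbb{F}$ be an algebraically closed field of characteristic zero. Every irreducible singular affine plane curve $\mathcal{C}\subset\mathbb{F}^2$ of degree less than or equal to $6$ is soluble by radicals. Here singular means that the projective closure $\overline{\mathcal{C}}\subset\mathbb{P}^2(\mathbb{F})$ has at least one singular point.
   Context: Let $t$ be transcendental over $\mathbb{F}$, $\mathbb{K}=\mathbb{F}(t)$, and fix an algebraic closure $\overline{\mathbb{K}}$ of $\mathbb{K}$. Root towers. For $g\in\mathbb{K}[x]$, a root tower for $g$ over $\mathbb{K}$ is a finite tower of fields $\mathbb{K}=\mathbb{K}_0\subset\mathbb{K}_1\subset\cdots\subset\mathbb{K}_s=\mathbb{E}$ (inside $\overline{\mathbb{K}}$) such that each $\mathbb{K}_i$ is the splitting field over $\mathbb{K}_{i-1}$ of a polynomial $x^{\ell_i}-a_i\in\mathbb{K}_{i-1}[x]$ with $\ell_i>0$, $a_i\neq0$, and the splitting field of $g$ over $\mathbb{K}$ is contained in $\mathbb{K}_s$; $g$ is soluble (by radicals) over $\mathbb{K}$ if such a tower exists. Affine square parametrization: a tuple $(R_1,\ldots,R_n)\in\mathbb{E}^n\setminus\mathbb{F}^n$, where $\mathbb{E}$ is the last field of a root tower over $\mathbb{K}$ of some $g\in\mathbb{K}[x]$ soluble over $\mathbb{K}$. Evaluation. For each $t_0\in\mathbb{F}$ fix a place of $\overline{\mathbb{K}}$ over $\mathbb{F}$ extending $t\mapsto t_0$, i.e. a valuation ring $O_{t_0}\supset\mathbb{F}$ of $\overline{\mathbb{K}}$ with $t-t_0$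 in its maximal ideal; its residue field is $\mathbb{F}$ (this is a compatible choice of the values at $t_0$ of all radicals). $S(t_0)$ is well defined if $S\in O_{t_0}$, and then it is the residue of $S$ in $\mathbb{F}$; tuples are evaluated coordinatewise. Soluble by radicals. An irreducible affine curve $\mathcal{E}\subset\mathbb{F}^n$ is soluble by radicals (parametrizable by radicals) if there is a finite set of square parametrizations $\{\mathcal{P}_i(t)\}_{i=1,\ldots,r}$ such that (1) for all $i$ and all $t_0\in\mathbb{F}$ such that $\mathcal{P}_i(t_0)$ is defined, $\mathcal{P}_i(t_0)\in\mathcal{E}$; (2) for all but finitely many $P\in\mathcal{E}$ there exist $t_0\in\mathbb{F}$ and $i$ with $P=\mathcal{P}_i(t_0)$. *)

theory Defs
  imports
    "HOL-Analysis.Finite_Cartesian_Product"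
    "HOL-Algebra.Generated_Fields"
    "HOL-Algebra.Algebraic_Closure_Type"
begin

section \<open>The field \<open>F(t)\<close> and its algebraic closure\<close>

type_synonym 'a ratfun = "'a poly fract"

type_synonym 'a ratfun_closure = "'a poly fract alg_closure"

definition const_closure :: "'a::field \<Rightarrow> 'a ratfun_closure" where
  "const_closure c = to_ac (to_fract [:c:])"

definition t_closure :: "'a::field ratfun_closure" where
  "t_closure = to_ac (to_fract [:0, 1:])"


section \<open>Root towers\<close>

definition splitting_field_in :: "'k::field set \<Rightarrow> 'k poly \<Rightarrow> 'k set" where
  "splitting_field_in L p = generate_field ring_of_type_algebra (L \<union> {z. poly p z = 0})"

text \<open>\<open>Ks 0, \<dots>, Ks s\<close> are the fields of the tower; the values \<open>Ks i\<close> for \<open>i > s\<close> are irrelevant.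
  The inclusions \<open>Ks i \<subseteq> Ks (Suc i)\<close> hold by construction and need not be strict.\<close>

definition root_tower ::
  "'a::field ratfun poly \<Rightarrow> nat \<Rightarrow> (nat \<Rightarrow> 'a ratfun_closure set) \<Rightarrow> bool" where
  "root_tower g s Ks \<longleftrightarrow>
     g \<noteq> 0 \<and>
     Ks 0 = range to_ac \<and>
     (\<forall>i<s. \<exists>l>0. \<exists>a\<in>Ks i. a \<noteq> 0 \<and>
        Ks (Suc i) = splitting_field_in (Ks i) (Polynomial.monom 1 l - [:a:])) \<and>
     splitting_field_in (range to_ac) (map_poly to_ac g) \<subseteq> Ks s"

definition square_parametrization :: "('a::field ratfun_closure) ^ 'n::finite \<Rightarrow> bool" where
  "square_parametrization P \<longleftrightarrow>
     (\<exists>g s Ks. root_tower g s Ks \<and> (\<forall>i. P $ i \<in> Ks s)) \<and>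
     \<not> (\<forall>i. P $ i \<in> range const_closure)"


section \<open>Places and evaluation\<close>

definition valuation_ring :: "'k::field set \<Rightarrow> bool" where
  "valuation_ring V \<longleftrightarrow> subring V ring_of_type_algebra \<and> (\<forall>x. x \<in> V \<or> inverse x \<in> V)"

definition valuation_ideal :: "'k::field set \<Rightarrow> 'k set" where
  "valuation_ideal V = {x \<in> V. x = 0 \<or> inverse x \<notin> V}"

definition place_at :: "'a::field \<Rightarrow> 'a ratfun_closure set \<Rightarrow> bool" where
  "place_at t0 V \<longleftrightarrow>
     valuation_ring V \<and> range const_closure \<subseteq> V \<and>
     t_closure - const_closure t0 \<in> valuation_ideal V"

text \<open>Over an algebraically closed \<open>F\<close>, the residue field of a place as above is \<open>F\<close>, so that the
  element \<open>c\<close> below exists for all \<open>S \<in> V\<close>; it is unique since a nonzero constant is a unit of \<open>V\<close>.\<close>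

definition residue_at :: "'a::field ratfun_closure set \<Rightarrow> 'a ratfun_closure \<Rightarrow> 'a" where
  "residue_at V S = (THE c. S - const_closure c \<in> valuation_ideal V)"

definition defined_at :: "'a::field ratfun_closure set \<Rightarrow> 'a ratfun_closure ^ 'n::finite \<Rightarrow> bool" where
  "defined_at V P \<longleftrightarrow> (\<forall>i. P $ i \<in> V)"

definition value_at :: "'a::field ratfun_closure set \<Rightarrow> 'a ratfun_closure ^ 'n::finite \<Rightarrow> 'a ^ 'n" where
  "value_at V P = (\<chi> i. residue_at V (P $ i))"

text \<open>\<open>Pl t0\<close> is the chosen place over \<open>t0\<close>.\<close>

definition soluble_by_radicals ::
  "('a::field \<Rightarrow> 'a ratfun_closure set) \<Rightarrow> ('a ^ 'n::finite) set \<Rightarrow> bool" where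
  "soluble_by_radicals Pl E \<longleftrightarrow>
     (\<exists>\<P>. finite \<P> \<and> (\<forall>P\<in>\<P>. square_parametrization P) \<and>
        (\<forall>P\<in>\<P>. \<forall>t0. defined_at (Pl t0) P \<longrightarrow> value_at (Pl t0) P \<in> E) \<and>
        finite {Q \<in> E. \<not> (\<exists>t0. \<exists>P\<in>\<P>. defined_at (Pl t0) P \<and> Q = value_at (Pl t0) P)})"


section \<open>Plane curves\<close>

text \<open>A polynomial in \<open>F[x, y]\<close> is an element of \<open>F[x][y]\<close>: \<open>coeff (coeff f j) i\<close> is the coefficient
  of \<open>x\<^sup>i y\<^sup>j\<close>. Likewise \<open>F[X, Y, Z]\<close> is \<open>F[X][Y][Z]\<close>.\<close>

definition eval2 :: "'a::comm_ring_1 poly poly \<Rightarrow> 'a ^ 2 \<Rightarrow> 'a" where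
  "eval2 f p = poly (poly f [:p $ 2:]) (p $ 1)"

definition eval3 :: "'a::comm_ring_1 poly poly poly \<Rightarrow> 'a ^ 3 \<Rightarrow> 'a" where
  "eval3 H p = poly (poly (poly H [:[:p $ 3:]:]) [:p $ 2:]) (p $ 1)"

definition affine_curve :: "'a::comm_ring_1 poly poly \<Rightarrow> ('a ^ 2) set" where
  "affine_curve f = {p. eval2 f p = 0}"

text \<open>The total degree; it is unspecified for \<open>f = 0\<close>.\<close>

definition curve_degree :: "'a::zero poly poly \<Rightarrow> nat" where
  "curve_degree f = Max {i + j | i j. Polynomial.coeff (Polynomial.coeff f j) i \<noteq> 0}"

definition homogenization :: "'a::comm_ring_1 poly poly \<Rightarrow> 'a poly poly poly" where
  "homogenization f =
     (let d = curve_degree f in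
      \<Sum>j\<le>d. \<Sum>i\<le>d - j.
        Polynomial.monom (Polynomial.monom
          (Polynomial.monom (Polynomial.coeff (Polynomial.coeff f j) i) i) j) (d - i - j))"

definition partial_X :: "'a::idom poly poly poly \<Rightarrow> 'a poly poly poly" where
  "partial_X = map_poly (map_poly pderiv)"

definition partial_Y :: "'a::idom poly poly poly \<Rightarrow> 'a poly poly poly" where
  "partial_Y = map_poly pderiv"

definition partial_Z :: "'a::idom poly poly poly \<Rightarrow> 'a poly poly poly" where
  "partial_Z = pderiv"

text \<open>For irreducible \<open>f\<close>, the projective closure of \<open>affine_curve f\<close> is the zero set of
  \<open>homogenization f\<close>. Its points are given by homogeneous coordinates \<open>p \<noteq> 0\<close>; the vanishing of
  homogeneous polynomials does not depend on the choice of these.\<close>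

definition singular_point_of_projective_closure ::
    "'a::idom poly poly \<Rightarrow> 'a ^ 3 \<Rightarrow> bool" where
  "singular_point_of_projective_closure f p \<longleftrightarrow>
     (let H = homogenization f in
      p \<noteq> 0 \<and> eval3 H p = 0 \<and>
      eval3 (partial_X H) p = 0 \<and> eval3 (partial_Y H) p = 0 \<and> eval3 (partial_Z H) p = 0)"

end

theory Submission
  imports Defs "HOL-Analysis.Cartesian_Space"
begin

text \<open>
  The idea is to project the curve from a singular point \<open>p\<close> of its projective closure. A line
  through \<open>p\<close> meets a curve of degree \<open>d \<le> 6\<close> in \<open>d\<close> points with multiplicity, and \<open>p\<close> takes up at
  least two of them. If \<open>t\<close> parametrizes the pencil of lines through \<open>p\<close> and \<open>s\<close> the points of a
  line, the remaining intersection points are thus the roots \<open>s\<close> of a polynomial \<open>G \<in> F[t][s]\<close> of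
  degree at most 4 in \<open>s\<close>. Such a polynomial is soluble by radicals over \<open>F(t)\<close> by the formulas of
  Cardano and Ferrari, and each of its roots \<open>z\<close> gives a square parametrization, namely the point
  \<open>z\<close> on the generic line of the pencil, unless this point is constant.

  Three things have to be shown. First, all roots of \<open>G\<close> lie in one root tower
  (\<open>degree_le_4_root_tower\<close>). The elements that can be reached from every tower by adjoining
  further radicals form a subfield that is closed under taking roots, and any polynomial of degree at most 4 over such a
  subfield has its roots there; so the formulas need no bookkeeping of towers.

  Second, every point of the curve off a finite set is a value of one of the parametrizations,
  whatever places were chosen. A point determines a line \<open>t\<^sub>0\<close> and a root \<open>s\<^sub>0\<close> of the specialization
  \<open>G(t\<^sub>0, \<cdot>)\<close>, and this root is the residue of some root of \<open>G\<close> (\<open>root_reducing_to\<close>). That holds even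
  where the leading coefficient of \<open>G\<close> vanishes, as long as \<open>G(t\<^sub>0, \<cdot>)\<close> is not zero: the roots
  outside the valuation ring have reciprocals with residue 0, hence do not contribute roots to the
  specialization. Conversely, residues exist and respect polynomial equations, so the values of a
  parametrization lie on the curve (\<open>value_at_in_curve\<close>).

  Third, the degree of \<open>G\<close> must be bounded (\<open>coeffs_subst3_singular\<close>). On a line through \<open>p\<close>, given
  by \<open>r p + s v\<close>, the homogenization \<open>H\<close> becomes a binary form whose coefficients of \<open>r\<^sup>d\<close> and
  \<open>r\<^sup>d\<^sup>-\<^sup>1 s\<close> are \<open>H(p)\<close> and the derivative of \<open>H\<close> at \<open>p\<close> along \<open>v\<close>; both vanish. For an affine
  point \<open>p\<close> one puts \<open>r = 1\<close>, and the two lowest coefficients in \<open>s\<close> vanish; for a point at infinity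
  the pencil consists of parallel lines, on which \<open>r\<close> is the coordinate, and the two highest ones
  vanish.

  The argument breaks down if the curve contains a line of the pencil, or the vertical line through
  an affine \<open>p\<close>, which has no slope. An irreducible curve is then that line itself and is
  parametrized by polynomials.
\<close>

section \<open>Polynomials of degree at most four\<close>

text \<open>
  The classical formulas are proved over a field in which all roots of its elements already lie, so
  that it does not matter how many radicals a formula uses or in which order they are adjoined.
  The ambient field is algebraically closed, which provides the auxiliary quantities of the formulas
  before they are known to lie in the subfield.
\<close>

locale radically_closed_subfield =
  fixes R :: "'k::{alg_closed_field, field_char_0} set"
  assumes one: "1 \<in> R"
    and add: "x \<in> R \<Longrightarrow> y \<in> R \<Longrightarrow> x + y \<in> R"
    and uminus: "x \<in> R \<Longrightarrow> - x \<in> R"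
    and mult: "x \<in> R \<Longrightarrow> y \<in> R \<Longrightarrow> x * y \<in> R"
    and inverse: "x \<in> R \<Longrightarrow> inverse x \<in> R"
    and root: "n > 0 \<Longrightarrow> x ^ n \<in> R \<Longrightarrow> x \<in> R"
begin

lemma diff: "x \<in> R \<Longrightarrow> y \<in> R \<Longrightarrow> x - y \<in> R"
  using add[of x "- y"] uminus[of y] by simp

lemma zero: "0 \<in> R"
  using diff[OF one one] by simp

lemma divide: "x \<in> R \<Longrightarrow> y \<in> R \<Longrightarrow> x / y \<in> R"
  by (simp add: divide_inverse mult inverse)

lemma power: "x \<in> R \<Longrightarrow> x ^ n \<in> R"
  by (induction n) (auto intro: one mult)

lemma of_nat: "of_nat n \<in> R"
  by (induction n) (auto intro: zero one add)

lemma numeral: "numeral n \<in> R"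
  using of_nat[of "numeral n"] by simp

lemmas closed = one zero add diff uminus mult divide power numeral

lemma quadratic:
  assumes "b \<in> R" "c \<in> R" and x: "x ^ 2 + b * x + c = 0"
  shows "x \<in> R"
proof -
  have "(2 * x + b) ^ 2 = 4 * (x ^ 2 + b * x + c) + (b ^ 2 - 4 * c)"
    by (simp add: algebra_simps power2_eq_square)
  hence "(2 * x + b) ^ 2 = b ^ 2 - 4 * c"
    using x by simp
  also have "\<dots> \<in> R"
    by (intro closed assms)
  finally have "2 * x + b \<in> R"
    by (rule root[rotated]) simp
  from divide[OF diff[OF this assms(1)] numeral[of "num.Bit0 num.One"]] show ?thesis by simp
qed

text \<open>
  Cardano's formula: write \<open>x = u + v\<close> with \<open>u v = - p / 3\<close>. Then \<open>u\<^sup>3 + v\<^sup>3 = - q\<close> and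
  \<open>u\<^sup>3 v\<^sup>3 = - p\<^sup>3 / 27\<close>, so that \<open>u\<^sup>3\<close> and \<open>v\<^sup>3\<close> are the roots of a quadratic polynomial over \<open>R\<close>.
\<close>

lemma depressed_cubic:
  assumes "p \<in> R" "q \<in> R" and x: "x ^ 3 + p * x + q = 0"
  shows "x \<in> R"
proof -
  \<comment> \<open>The polynomial is \<open>(T - u) (T - v)\<close> with sum \<open>x\<close> and product \<open>- p / 3\<close> of its roots.\<close>
  have "degree [:- (p / 3), - x, 1:] > 0"
    by simp
  then obtain u where u: "poly [:- (p / 3), - x, 1:] u = 0"
    using alg_closed_imp_poly_has_root by blast
  define v where "v = x - u"
  have uv: "3 * (u * v) = - p"
    using u by (simp add: v_def field_simps power2_eq_square)
  have xuv: "x = u + v" by (simp add: v_def)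
  have sum: "u ^ 3 + v ^ 3 = - q"
  proof -
    have "(u + v) ^ 3 + p * (u + v) + q = u ^ 3 + v ^ 3 + q + (3 * (u * v) + p) * (u + v)"
      by (simp add: algebra_simps power3_eq_cube)
    thus ?thesis
      using x uv unfolding xuv by (simp add: eq_neg_iff_add_eq_0)
  qed
  have prod: "27 * (u ^ 3 * v ^ 3) = - (p ^ 3)"
  proof -
    have "27 * (u ^ 3 * v ^ 3) = (3 * (u * v)) ^ 3"
      by (simp add: power_mult_distrib)
    thus ?thesis unfolding uv by simp
  qed
  have "27 * ((u ^ 3) ^ 2 + q * u ^ 3 + - (p ^ 3) / 27) = 27 * (u ^ 3 * (u ^ 3 + q)) - p ^ 3"
    by (simp add: algebra_simps power2_eq_square)
  also have "u ^ 3 + q = - (v ^ 3)"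
    using sum by (simp add: eq_neg_iff_add_eq_0 add_ac)
  also have "27 * (u ^ 3 * - (v ^ 3)) - p ^ 3 = 0"
    using prod by simp
  finally have "27 * ((u ^ 3) ^ 2 + q * u ^ 3 + - (p ^ 3) / 27) = 0" .
  hence "(u ^ 3) ^ 2 + q * u ^ 3 + - (p ^ 3) / 27 = 0"
    by (metis mult_eq_0_iff zero_neq_numeral)
  hence "u ^ 3 \<in> R"
    by (rule quadratic[rotated 2]) (intro closed assms)+
  moreover from this have "v ^ 3 \<in> R"
    using diff[OF uminus[OF assms(2)], of "u ^ 3"] sum by (metis add_diff_cancel_left')
  ultimately have "u \<in> R" "v \<in> R"
    using root[of 3] by simp_all
  thus ?thesis
    unfolding xuv by (rule add)
qed

lemma cubic:
  assumes "b \<in> R" "c \<in> R" "d \<in> R" and x: "x ^ 3 + b * x ^ 2 + c * x + d = 0"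
  shows "x \<in> R"
proof -
  \<comment> \<open>Shifting by \<open>b'\<close> removes the quadratic term.\<close>
  define b' where "b' = b / 3"
  have b: "b = 3 * b'" by (simp add: b'_def)
  have b'R: "b' \<in> R" unfolding b'_def by (intro closed assms)
  have "(x + b') ^ 3 + (c - 3 * b' ^ 2) * (x + b') + (2 * b' ^ 3 - b' * c + d)
          = x ^ 3 + 3 * b' * x ^ 2 + c * x + d"
    by (simp add: algebra_simps power2_eq_square power3_eq_cube)
  also have "\<dots> = 0"
    using x unfolding b .
  finally have "x + b' \<in> R"
    by (rule depressed_cubic[rotated 2]) (intro closed assms b'R)+
  from diff[OF this b'R] show ?thesis by simp
qed

text \<open>
  Ferrari's method: for a root \<open>m\<close> of the resolvent cubic and \<open>w\<^sup>2 = 2 m\<close>, the quartic polynomial is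
  the difference of the squares of \<open>x\<^sup>2 + p / 2 + m\<close> and \<open>w x - k\<close> with \<open>k = q / (2 w)\<close>, and so a
  product of two quadratic polynomials over \<open>R\<close>. The division by \<open>w\<close> is possible unless \<open>q = 0\<close>,
  in which case the polynomial is quadratic in \<open>x\<^sup>2\<close>.
\<close>

lemma depressed_quartic:
  assumes pqr: "p \<in> R" "q \<in> R" "r \<in> R" and x: "x ^ 4 + p * x ^ 2 + q * x + r = 0"
  shows "x \<in> R"
proof (cases "q = 0")
  case True
  have "(x ^ 2) ^ 2 + p * x ^ 2 + r = 0"
    using x True by (simp flip: power_mult)
  hence "x ^ 2 \<in> R"
    by (rule quadratic[rotated 2]) fact+
  thus ?thesis
    using root[of 2] by simp
next
  case False
  have "degree [:- (q ^ 2) / 8, (2 * p ^ 2 - 8 * r) / 8, p, 1:] > 0"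
    by simp
  then obtain m where m: "poly [:- (q ^ 2) / 8, (2 * p ^ 2 - 8 * r) / 8, p, 1:] m = 0"
    using alg_closed_imp_poly_has_root by blast
  have m': "m ^ 3 + p * m ^ 2 + (2 * p ^ 2 - 8 * r) / 8 * m + - (q ^ 2) / 8 = 0"
    using m by (simp add: algebra_simps power2_eq_square power3_eq_cube)
  from m' have mR: "m \<in> R"
    by (rule cubic[rotated 3]) (intro closed pqr)+
  have m8: "8 * m ^ 3 + 8 * p * m ^ 2 + (2 * p ^ 2 - 8 * r) * m = q ^ 2"
  proof -
    have "8 * (m ^ 3 + p * m ^ 2 + (2 * p ^ 2 - 8 * r) / 8 * m + - (q ^ 2) / 8)
            = 8 * m ^ 3 + 8 * p * m ^ 2 + (2 * p ^ 2 - 8 * r) * m - q ^ 2"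
      by (simp add: field_simps)
    thus ?thesis unfolding m' by simp
  qed
  with False have m0: "m \<noteq> 0" by auto
  obtain w where w: "w ^ 2 = 2 * m"
    using alg_closed_imp_poly_has_root[of "[:- (2 * m), 0, 1:]"] by (auto simp: power2_eq_square)
  have wR: "w \<in> R"
    using root[of 2 w] w by (simp add: closed mR)
  have w0: "w \<noteq> 0" using w m0 by auto
  define k where "k = q / (2 * w)"
  have kR: "k \<in> R" unfolding k_def by (intro closed pqr wR)
  have q: "q = 2 * w * k" using w0 by (simp add: k_def)
  have "m * (8 * m ^ 2 + 8 * p * m + 2 * p ^ 2 - 8 * r)
          = 8 * m ^ 3 + 8 * p * m ^ 2 + (2 * p ^ 2 - 8 * r) * m"
    by (simp add: algebra_simps power2_eq_square power3_eq_cube)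
  also have "\<dots> = 4 * w ^ 2 * k ^ 2"
    unfolding m8 q by (simp add: power_mult_distrib)
  also have "\<dots> = m * (8 * k ^ 2)"
    unfolding w by simp
  finally have "m * (8 * m ^ 2 + 8 * p * m + 2 * p ^ 2 - 8 * r) = m * (8 * k ^ 2)" .
  hence k2: "8 * m ^ 2 + 8 * p * m + 2 * p ^ 2 - 8 * r = 8 * k ^ 2"
    using m0 by simp
  define p' where "p' = p / 2"
  have p: "p = 2 * p'" by (simp add: p'_def)
  have p'R: "p' \<in> R" unfolding p'_def by (intro closed pqr)
  have "8 * ((x ^ 2 + w * x + (p' + m - k)) * (x ^ 2 + - w * x + (p' + m + k)))
          = 8 * (x ^ 4 + 2 * p' * x ^ 2 + 2 * w * k * x + r) + 8 * (2 * m - w ^ 2) * x ^ 2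
            + (8 * m ^ 2 + 8 * (2 * p') * m + 2 * (2 * p') ^ 2 - 8 * r - 8 * k ^ 2)"
    by (simp add: algebra_simps power2_eq_square power4_eq_xxxx)
  also have "\<dots> = 0"
    using x k2 w unfolding p q by simp
  finally have "8 * ((x ^ 2 + w * x + (p' + m - k)) * (x ^ 2 + - w * x + (p' + m + k))) = 0" .
  hence "x ^ 2 + w * x + (p' + m - k) = 0 \<or> x ^ 2 + - w * x + (p' + m + k) = 0"
    by simp
  thus ?thesis
    by (elim disjE; elim quadratic[rotated 2]) (intro closed wR p'R mR kR)+
qed

lemma quartic:
  assumes "b \<in> R" "c \<in> R" "d \<in> R" "e \<in> R"
    and x: "x ^ 4 + b * x ^ 3 + c * x ^ 2 + d * x + e = 0"
  shows "x \<in> R"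
proof -
  \<comment> \<open>Shifting by \<open>b'\<close> removes the cubic term.\<close>
  define b' where "b' = b / 4"
  have b: "b = 4 * b'" by (simp add: b'_def)
  have b'R: "b' \<in> R" unfolding b'_def by (intro closed assms)
  have "(x + b') ^ 4 + (c - 6 * b' ^ 2) * (x + b') ^ 2 + (d - 2 * b' * c + 8 * b' ^ 3) * (x + b')
          + (e - b' * d + b' ^ 2 * c - 3 * b' ^ 4)
          = x ^ 4 + 4 * b' * x ^ 3 + c * x ^ 2 + d * x + e"
    by (simp add: algebra_simps power2_eq_square power3_eq_cube power4_eq_xxxx)
  also have "\<dots> = 0"
    using x unfolding b .
  finally have "x + b' \<in> R"
    by (rule depressed_quartic[rotated 3]) (intro closed assms b'R)+
  from diff[OF this b'R] show ?thesis by simp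
qed

lemma root_of_degree_le_4:
  assumes "p \<noteq> 0" "degree p \<le> 4" and coeffs: "\<And>i. poly.coeff p i \<in> R" and x: "poly p x = 0"
  shows "x \<in> R"
proof -
  define a where "a = lead_coeff p"
  define c where "c i = poly.coeff p i / a" for i
  have a: "a \<noteq> 0" using assms(1) by (simp add: a_def)
  have cR: "c i \<in> R" for i
    unfolding c_def a_def by (intro closed coeffs)
  have "(\<Sum>i\<le>degree p. c i * x ^ i) = poly p x / a"
    by (simp add: poly_altdef c_def sum_divide_distrib)
  hence sum: "(\<Sum>i\<le>degree p. c i * x ^ i) = 0" using x by simp
  have lead: "c (degree p) = 1"
    using a by (simp add: c_def a_def)
  have "degree p = 0 \<or> degree p = 1 \<or> degree p = 2 \<or> degree p = 3 \<or> degree p = 4"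
    using assms(2) by linarith
  thus ?thesis
  proof (elim disjE)
    assume "degree p = 0"
    thus ?thesis using sum lead by simp
  next
    assume d: "degree p = 1"
    hence "x = - c 0" using sum lead by (simp add: eq_neg_iff_add_eq_0 add.commute)
    thus ?thesis by (simp add: closed cR)
  next
    assume d: "degree p = 2"
    show ?thesis
      by (rule quadratic[OF cR[of 1] cR[of 0]])
         (use sum lead d in \<open>simp add: numeral_eq_Suc add_ac\<close>)
  next
    assume d: "degree p = 3"
    show ?thesis
      by (rule cubic[OF cR[of 2] cR[of 1] cR[of 0]])
         (use sum lead d in \<open>simp add: numeral_eq_Suc add_ac\<close>)
  next
    assume d: "degree p = 4"
    show ?thesis
      by (rule quartic[OF cR[of 3] cR[of 2] cR[of 1] cR[of 0]])
         (use sum lead d in \<open>simp add: numeral_eq_Suc add_ac\<close>)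
  qed
qed

end

section \<open>Root towers\<close>

text \<open>The formulas divide by 2 and 3, hence characteristic zero has to carry over to \<open>F(t)\<close>.\<close>

instance fract :: ("{idom, ring_char_0}") field_char_0
proof
  show "inj (of_nat :: nat \<Rightarrow> 'a fract)"
    by (rule injI) (metis of_nat_fract to_fract_def to_fract_eq_iff of_nat_eq_iff)
qed

text \<open>
  The last fields of towers, without the condition that a given polynomial splits there: a tower is
  built first, and is used afterwards for any polynomial whose roots it contains.
\<close>

inductive radical_tower_top :: "'a::field ratfun_closure set \<Rightarrow> bool" where
  base: "radical_tower_top (range to_ac)"
| step: "radical_tower_top L \<Longrightarrow> a \<in> L \<Longrightarrow> a \<noteq> 0 \<Longrightarrow> l > 0 \<Longrightarrow>
    radical_tower_top (splitting_field_in L (Polynomial.monom 1 l - [:a:]))"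

lemma radical_tower_top_imp_tower:
  assumes "radical_tower_top (L :: 'a::field ratfun_closure set)"
  shows "\<exists>s (Ks :: nat \<Rightarrow> 'a ratfun_closure set). Ks s = L \<and> Ks 0 = range to_ac \<and>
     (\<forall>i<s. \<exists>l>0. \<exists>a\<in>Ks i. a \<noteq> 0 \<and>
        Ks (Suc i) = splitting_field_in (Ks i) (Polynomial.monom 1 l - [:a:]))"
  using assms
proof induction
  case base
  show ?case by (rule exI[of _ 0]) auto
next
  case (step L a l)
  then obtain s Ks where Ks: "Ks s = L" "Ks 0 = range to_ac"
    "\<forall>i<s. \<exists>l>0. \<exists>a\<in>Ks i. a \<noteq> 0 \<and>
        Ks (Suc i) = splitting_field_in (Ks i) (Polynomial.monom 1 l - [:a:])"
    by blast
  define Ls where "Ls = Ks (Suc s := splitting_field_in L (Polynomial.monom 1 l - [:a:]))"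
  have "\<exists>l>0. \<exists>a\<in>Ls i. a \<noteq> 0 \<and>
        Ls (Suc i) = splitting_field_in (Ls i) (Polynomial.monom 1 l - [:a:])" if "i < Suc s" for i
  proof (cases "i = s")
    case True
    thus ?thesis
      using Ks(1) step.hyps by (auto simp: Ls_def)
  next
    case False
    thus ?thesis
      using Ks(3) that by (auto simp: Ls_def)
  qed
  moreover have "Ls (Suc s) = splitting_field_in L (Polynomial.monom 1 l - [:a:])" "Ls 0 = range to_ac"
    using Ks by (auto simp: Ls_def)
  ultimately show ?case by blast
qed

definition is_subfield :: "'k::field set \<Rightarrow> bool" where
  "is_subfield L \<longleftrightarrow> 1 \<in> L \<and> (\<forall>x\<in>L. \<forall>y\<in>L. x + y \<in> L \<and> x * y \<in> L) \<and> (\<forall>x\<in>L. - x \<in> L \<and> inverse x \<in> L)"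

lemma type_algebra_simps:
  "\<one>\<^bsub>ring_of_type_algebra\<^esub> = (1 :: 'k::field)"
  "\<zero>\<^bsub>ring_of_type_algebra\<^esub> = (0 :: 'k)"
  "x \<otimes>\<^bsub>ring_of_type_algebra\<^esub> y = (x * y :: 'k)"
  "x \<oplus>\<^bsub>ring_of_type_algebra\<^esub> y = (x + y :: 'k)"
  "carrier (ring_of_type_algebra :: 'k ring) = UNIV"
  by (simp_all add: ring_of_type_algebra_def)

lemma type_algebra_uminus: "\<ominus>\<^bsub>ring_of_type_algebra\<^esub> x = (- x :: 'k::field)"
proof -
  interpret field "ring_of_type_algebra :: 'k ring" by (rule field_from_type_algebra)
  have "x \<oplus>\<^bsub>ring_of_type_algebra\<^esub> (- x) = \<zero>\<^bsub>ring_of_type_algebra\<^esub>"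
    by (simp add: type_algebra_simps)
  thus ?thesis
    by (metis UNIV_I add.m_comm minus_equality type_algebra_simps(5))
qed

lemma type_algebra_inverse: "x \<noteq> 0 \<Longrightarrow> inv\<^bsub>ring_of_type_algebra\<^esub> x = (inverse x :: 'k::field)"
proof -
  assume "x \<noteq> 0"
  interpret field "ring_of_type_algebra :: 'k ring" by (rule field_from_type_algebra)
  have "x \<otimes>\<^bsub>ring_of_type_algebra\<^esub> inverse x = \<one>\<^bsub>ring_of_type_algebra\<^esub>"
    using \<open>x \<noteq> 0\<close> by (simp add: type_algebra_simps)
  thus ?thesis
    by (metis UNIV_I comm_inv_char type_algebra_simps(5))
qed

lemma is_subfield_generate_field: "is_subfield (generate_field ring_of_type_algebra H)"
proof -
  let ?R = "ring_of_type_algebra :: 'a ring"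
  note intros = generate_field.intros[where R = ?R and H = H]
  have "0 \<in> generate_field ?R H"
    using intros(5)[OF intros(1) intros(3)[OF intros(1)]]
    by (simp add: type_algebra_simps type_algebra_uminus)
  hence "inverse x \<in> generate_field ?R H" if "x \<in> generate_field ?R H" for x
    using intros(4)[OF that] by (cases "x = 0") (simp_all add: type_algebra_simps type_algebra_inverse)
  thus ?thesis
    using intros(1,3,5,6) unfolding is_subfield_def
    by (simp add: type_algebra_simps type_algebra_uminus)
qed

lemma is_subfield_range_to_ac: "is_subfield (range to_ac)"
  unfolding is_subfield_def
  by (auto simp flip: to_ac_1 to_ac_add to_ac_mult to_ac_minus to_ac_inverse)

lemma is_subfield_tower_top: "radical_tower_top L \<Longrightarrow> is_subfield L"
  by (induction rule: radical_tower_top.induct)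
     (auto simp: splitting_field_in_def is_subfield_generate_field is_subfield_range_to_ac)

lemma range_to_ac_subset_tower_top: "radical_tower_top L \<Longrightarrow> range to_ac \<subseteq> L"
  by (induction rule: radical_tower_top.induct)
     (auto simp: splitting_field_in_def intro!: generate_field.incl)

lemma generate_field_subset:
  assumes "is_subfield L" "H \<subseteq> L"
  shows "generate_field ring_of_type_algebra H \<subseteq> L"
proof
  fix x assume "x \<in> generate_field ring_of_type_algebra H"
  thus "x \<in> L"
    using assms
    by induction (auto simp: is_subfield_def type_algebra_simps type_algebra_uminus type_algebra_inverse)
qed

text \<open>
  Any two elements expressible by radicals lie in a common tower, because the radicals of one can be
  adjoined on top of a tower for the other. The quantification over all \<open>L\<close> builds this argument
  into the definition.
\<close>

definition radical_elements :: "'a::field ratfun_closure set" where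
  "radical_elements = {z. \<forall>L. radical_tower_top L \<longrightarrow> (\<exists>L'. radical_tower_top L' \<and> L \<subseteq> L' \<and> z \<in> L')}"

lemma radical_elements_finite:
  assumes "finite A" "A \<subseteq> radical_elements"
  shows "radical_tower_top L \<Longrightarrow> \<exists>L'. radical_tower_top L' \<and> L \<subseteq> L' \<and> A \<subseteq> L'"
  using assms
proof (induction A)
  case (insert z A)
  then obtain L' where "radical_tower_top L'" "L \<subseteq> L'" "A \<subseteq> L'" by auto
  moreover from this obtain L'' where "radical_tower_top L''" "L' \<subseteq> L''" "z \<in> L''"
    using insert.prems by (auto simp: radical_elements_def)
  ultimately show ?case by (meson insert_subset subset_trans)
qed auto

lemma range_to_ac_radical: "to_ac k \<in> radical_elements"
  using range_to_ac_subset_tower_top unfolding radical_elements_def by blast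

lemma radical_elementsI:
  assumes "finite A" "A \<subseteq> radical_elements"
    and "\<And>L. is_subfield L \<Longrightarrow> A \<subseteq> L \<Longrightarrow> z \<in> L"
  shows "z \<in> radical_elements"
  using radical_elements_finite[OF assms(1,2)] is_subfield_tower_top assms(3)
  unfolding radical_elements_def by blast

lemma radical_elements_root:
  assumes "n > 0" "z ^ n \<in> radical_elements"
  shows "z \<in> radical_elements"
proof (cases "z = 0")
  case True
  thus ?thesis using range_to_ac_radical[of 0] by simp
next
  case False
  show ?thesis
    unfolding radical_elements_def
  proof (clarify)
    fix L :: "'a ratfun_closure set" assume "radical_tower_top L"
    then obtain L' where L': "radical_tower_top L'" "L \<subseteq> L'" "z ^ n \<in> L'"
      using assms(2) unfolding radical_elements_def by blast
    let ?L = "splitting_field_in L' (Polynomial.monom 1 n - [:z ^ n:])"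
    have "radical_tower_top ?L"
      using L' assms(1) False by (intro radical_tower_top.step) auto
    moreover have "z \<in> ?L" "L' \<subseteq> ?L"
      unfolding splitting_field_in_def
      by (auto intro!: generate_field.incl simp: poly_monom)
    ultimately show "\<exists>L'. radical_tower_top L' \<and> L \<subseteq> L' \<and> z \<in> L'"
      using L' by blast
  qed
qed

lemma radically_closed_radical_elements:
  "radically_closed_subfield (radical_elements :: 'a::field_char_0 ratfun_closure set)"
proof
  fix x y :: "'a ratfun_closure" assume xy: "x \<in> radical_elements" "y \<in> radical_elements"
  show "x + y \<in> radical_elements" "x * y \<in> radical_elements"
    by (rule radical_elementsI[of "{x, y}"]; use xy in \<open>simp add: is_subfield_def\<close>)+
next
  fix x :: "'a ratfun_closure" assume x: "x \<in> radical_elements"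
  show "- x \<in> radical_elements" "inverse x \<in> radical_elements"
    by (rule radical_elementsI[of "{x}"]; use x in \<open>simp add: is_subfield_def\<close>)+
next
  show "1 \<in> (radical_elements :: 'a ratfun_closure set)"
    using range_to_ac_radical[of 1] by simp
qed (rule radical_elements_root)

text \<open>
  All roots of \<open>g\<close> are radical elements by the classical formulas. As they are finitely many, a
  single tower contains them.
\<close>

lemma degree_le_4_root_tower:
  fixes g :: "'a::field_char_0 ratfun poly"
  assumes "g \<noteq> 0" "degree g \<le> 4"
  shows "\<exists>s Ks. root_tower g s Ks \<and> is_subfield (Ks s)"
proof -
  interpret radically_closed_subfield "radical_elements :: 'a ratfun_closure set"
    by (rule radically_closed_radical_elements)
  let ?g = "map_poly to_ac g :: 'a ratfun_closure poly"
  have g: "?g \<noteq> 0" "degree ?g \<le> 4"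
    using assms by (auto simp: map_poly_eq_0_iff degree_map_poly)
  have "{z. poly ?g z = 0} \<subseteq> radical_elements"
    using root_of_degree_le_4[OF g] by (auto simp: coeff_map_poly range_to_ac_radical)
  with poly_roots_finite[OF g(1)] obtain L where L: "radical_tower_top L" "{z. poly ?g z = 0} \<subseteq> L"
    using radical_elements_finite radical_tower_top.base by blast
  obtain s Ks where Ks: "Ks s = L" "Ks 0 = range to_ac"
    "\<forall>i<s. \<exists>l>0. \<exists>a\<in>Ks i. a \<noteq> 0 \<and>
        Ks (Suc i) = splitting_field_in (Ks i) (Polynomial.monom 1 l - [:a:])"
    using radical_tower_top_imp_tower[OF L(1)] by blast
  have "splitting_field_in (range to_ac) ?g \<subseteq> L"
    unfolding splitting_field_in_def
    using L range_to_ac_subset_tower_top by (intro generate_field_subset is_subfield_tower_top) auto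
  thus ?thesis
    using Ks assms(1) is_subfield_tower_top[OF L(1)] unfolding root_tower_def by blast
qed

section \<open>Evaluation of polynomials along ring homomorphisms\<close>

definition is_ring_hom :: "('a::comm_ring_1 \<Rightarrow> 'b::comm_ring_1) \<Rightarrow> bool" where
  "is_ring_hom h \<longleftrightarrow> h 1 = 1 \<and> (\<forall>x y. h (x + y) = h x + h y \<and> h (x * y) = h x * h y)"

lemma
  assumes "is_ring_hom h"
  shows ring_hom_1: "h 1 = 1"
    and ring_hom_add: "h (x + y) = h x + h y"
    and ring_hom_mult: "h (x * y) = h x * h y"
  using assms by (auto simp: is_ring_hom_def)

lemma ring_hom_0: "is_ring_hom h \<Longrightarrow> h 0 = 0"
  using ring_hom_add[of h 0 0] by simp

lemma ring_hom_power: "is_ring_hom h \<Longrightarrow> h (x ^ n) = h x ^ n"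
  by (induction n) (simp_all add: ring_hom_1 ring_hom_mult)

lemma ring_hom_sum: "is_ring_hom h \<Longrightarrow> h (sum f A) = (\<Sum>x\<in>A. h (f x))"
  by (induction A rule: infinite_finite_induct) (simp_all add: ring_hom_0 ring_hom_add)

text \<open>
  Evaluation of a polynomial after a change of the coefficient ring. It is itself a ring homomorphism,
  and all specializations below are composed from it.
\<close>

definition eval_along :: "('a::comm_ring_1 \<Rightarrow> 'b::comm_ring_1) \<Rightarrow> 'b \<Rightarrow> 'a poly \<Rightarrow> 'b" where
  "eval_along h z p = poly (map_poly h p) z"

lemma eval_along_0 [simp]: "eval_along h z 0 = 0"
  by (simp add: eval_along_def)

lemma eval_along_pCons: "h 0 = 0 \<Longrightarrow> eval_along h z (pCons a p) = h a + z * eval_along h z p"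
  by (simp add: eval_along_def map_poly_pCons)

lemma is_ring_hom_eval_along:
  assumes h: "is_ring_hom h"
  shows "is_ring_hom (eval_along h z)"
proof -
  note [simp] = ring_hom_0[OF h] ring_hom_1[OF h] ring_hom_add[OF h] ring_hom_mult[OF h]
    eval_along_pCons
  have add: "eval_along h z (p + q) = eval_along h z p + eval_along h z q" for p q
    by (induction p q rule: poly_induct2) (simp_all add: algebra_simps)
  have smult: "eval_along h z (smult a p) = h a * eval_along h z p" for a p
    by (induction p) (simp_all add: algebra_simps)
  have mult: "eval_along h z (p * q) = eval_along h z p * eval_along h z q" for p q
    by (induction p) (simp_all add: add smult algebra_simps)
  show ?thesis
    unfolding is_ring_hom_def using add mult by (auto simp: one_pCons)
qed

definition poly_closure :: "'a::field poly \<Rightarrow> 'a ratfun_closure" where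
  "poly_closure p = to_ac (to_fract p)"

lemma const_closure_eq_poly_closure: "const_closure c = poly_closure [:c:]"
  by (simp add: const_closure_def poly_closure_def)

lemma is_ring_hom_poly_closure: "is_ring_hom poly_closure"
  by (simp add: is_ring_hom_def poly_closure_def)

lemma poly_closure_eq_0_iff: "poly_closure p = 0 \<longleftrightarrow> p = 0"
  by (simp add: poly_closure_def)

lemma is_ring_hom_const: "is_ring_hom const_closure"
  unfolding is_ring_hom_def const_closure_def
  by (simp flip: to_ac_add to_ac_mult to_fract_add to_fract_mult one_pCons)

lemma poly_closure_pCons: "poly_closure (pCons a p) = const_closure a + t_closure * poly_closure p"
proof -
  have "pCons a p = [:a:] + [:0, 1:] * p" by simp
  thus ?thesis
    by (metis ring_hom_add[OF is_ring_hom_poly_closure] ring_hom_mult[OF is_ring_hom_poly_closure]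
        const_closure_eq_poly_closure t_closure_def poly_closure_def)
qed

lemma is_ring_hom_eval: "is_ring_hom (\<lambda>P. poly (poly P [:s:]) t)"
  by (simp add: is_ring_hom_def)

section \<open>Places\<close>

locale place =
  fixes t0 :: "'a::{alg_closed_field, field_char_0}" and V :: "'a ratfun_closure set"
  assumes place: "place_at t0 V"
begin

abbreviation "M \<equiv> valuation_ideal V"

lemma
  shows V_0: "0 \<in> V" and V_1: "1 \<in> V"
    and V_uminus: "x \<in> V \<Longrightarrow> - x \<in> V"
    and V_mult: "x \<in> V \<Longrightarrow> y \<in> V \<Longrightarrow> x * y \<in> V"
    and V_add: "x \<in> V \<Longrightarrow> y \<in> V \<Longrightarrow> x + y \<in> V"
    and V_inverse: "x \<notin> V \<Longrightarrow> inverse x \<in> V"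
proof -
  have V: "subring V ring_of_type_algebra" "\<forall>x. x \<in> V \<or> inverse x \<in> V"
    using place by (auto simp: place_at_def valuation_ring_def)
  note * = subringE[OF V(1), unfolded type_algebra_simps type_algebra_uminus]
  show "0 \<in> V" "1 \<in> V" by (fact *)+
  show "x \<in> V \<Longrightarrow> - x \<in> V" "x \<in> V \<Longrightarrow> y \<in> V \<Longrightarrow> x * y \<in> V" "x \<in> V \<Longrightarrow> y \<in> V \<Longrightarrow> x + y \<in> V"
    by (rule *; assumption)+
  show "x \<notin> V \<Longrightarrow> inverse x \<in> V" using V(2) by blast
qed

lemma V_diff: "x \<in> V \<Longrightarrow> y \<in> V \<Longrightarrow> x - y \<in> V"
  using V_add[of x "- y"] V_uminus[of y] by simp

lemma V_const: "const_closure c \<in> V"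
  using place by (auto simp: place_at_def)

lemma M_imp_V: "x \<in> M \<Longrightarrow> x \<in> V"
  by (simp add: valuation_ideal_def)

lemma M_0: "0 \<in> M"
  by (simp add: valuation_ideal_def V_0)

lemma M_mult: "a \<in> V \<Longrightarrow> x \<in> M \<Longrightarrow> a * x \<in> M"
proof -
  assume a: "a \<in> V" "x \<in> M"
  have False if "a * x \<noteq> 0" "inverse (a * x) \<in> V"
  proof -
    have "inverse x = a * inverse (a * x)" using that by (simp add: field_simps)
    hence "inverse x \<in> V" using a that V_mult by metis
    moreover have "x \<noteq> 0" using that by auto
    ultimately show False using a unfolding valuation_ideal_def by auto
  qed
  moreover have "a * x \<in> V" using a V_mult M_imp_V by blast
  ultimately show ?thesis
    unfolding valuation_ideal_def by blast
qed

text \<open>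
  One of the two quotients of \<open>x\<close> and \<open>y\<close> lies in the valuation ring, so \<open>x + y\<close> is a multiple of
  \<open>y\<close> or of \<open>x\<close>.
\<close>

lemma M_add_aux:
  assumes "x \<in> M" "y \<in> M" "y \<noteq> 0" "x / y \<in> V"
  shows "x + y \<in> M"
proof -
  have "x + y = (x / y + 1) * y" using assms by (simp add: field_simps)
  thus ?thesis using M_mult[OF V_add[OF assms(4) V_1] assms(2)] by simp
qed

lemma M_add:
  assumes "x \<in> M" "y \<in> M"
  shows "x + y \<in> M"
proof (cases "x = 0 \<or> y = 0")
  case True
  thus ?thesis using assms by auto
next
  case False
  have "x / y \<in> V \<or> y / x \<in> V"
    using V_inverse[of "x / y"] by auto
  thus ?thesis
    using M_add_aux[of x y] M_add_aux[of y x] assms False by (auto simp: add.commute)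
qed

lemma M_uminus: "x \<in> M \<Longrightarrow> - x \<in> M"
  using M_mult[OF V_uminus[OF V_1], of x] by simp

lemma M_diff: "x \<in> M \<Longrightarrow> y \<in> M \<Longrightarrow> x - y \<in> M"
  using M_add[of x "- y"] M_uminus[of y] by simp

lemma M_prime:
  assumes "x \<in> V" "y \<in> V" "x * y \<in> M"
  shows "x \<in> M \<or> y \<in> M"
  using assms V_mult[of "inverse x" "inverse y"] unfolding valuation_ideal_def
  by auto

lemma M_prime_prod_mset:
  assumes "\<And>x. x \<in># A \<Longrightarrow> h x \<in> V" "(\<Prod>x\<in>#A. h x) \<in> M"
  shows "\<exists>x\<in>#A. h x \<in> M"
proof -
  have "(\<Prod>x\<in>#A. h x) \<in> V \<and> ((\<Prod>x\<in>#A. h x) \<in> M \<longrightarrow> (\<exists>x\<in>#A. h x \<in> M))"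
    using assms(1)
  proof (induction A)
    case empty
    show ?case by (auto simp: V_1 valuation_ideal_def)
  next
    case (add x A)
    thus ?case
      using V_mult[of "h x" "\<Prod>x\<in>#A. h x"] M_prime[of "h x" "\<Prod>x\<in>#A. h x"] by auto
  qed
  thus ?thesis using assms(2) by blast
qed

lemma M_const: "const_closure c \<in> M \<Longrightarrow> c = 0"
proof (rule ccontr)
  assume c: "const_closure c \<in> M" "c \<noteq> 0"
  hence "const_closure c * const_closure (inverse c) = 1"
    by (simp flip: ring_hom_mult[OF is_ring_hom_const] add: ring_hom_1[OF is_ring_hom_const])
  hence "inverse (const_closure c) = const_closure (inverse c)" "const_closure c \<noteq> 0"
    using inverse_unique by (blast, force)
  with c V_const show False by (auto simp: valuation_ideal_def)
qed

text \<open>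
  As a relation, having residue \<open>c\<close> is compatible with the ring operations even before residues are
  known to exist.
\<close>

definition reduces_to :: "'a ratfun_closure \<Rightarrow> 'a \<Rightarrow> bool" where
  "reduces_to x c \<longleftrightarrow> x - const_closure c \<in> M"

lemma reduces_to_imp_V: "reduces_to x c \<Longrightarrow> x \<in> V"
  using V_add[OF M_imp_V V_const, of "x - const_closure c" c] by (simp add: reduces_to_def)

lemma reduces_to_const: "reduces_to (const_closure c) c"
  by (simp add: reduces_to_def M_0)

lemma reduces_to_0_iff: "reduces_to x 0 \<longleftrightarrow> x \<in> M"
  by (simp add: reduces_to_def ring_hom_0[OF is_ring_hom_const])

lemma reduces_to_t: "reduces_to t_closure t0"
  using place by (simp add: reduces_to_def place_at_def)

lemma reduces_to_add:
  assumes "reduces_to x a" "reduces_to y b"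
  shows "reduces_to (x + y) (a + b)"
  using M_add[OF assms[unfolded reduces_to_def]]
  by (simp add: reduces_to_def ring_hom_add[OF is_ring_hom_const] algebra_simps)

lemma reduces_to_mult:
  assumes "reduces_to x a" "reduces_to y b"
  shows "reduces_to (x * y) (a * b)"
proof -
  have "y * (x - const_closure a) + const_closure a * (y - const_closure b) \<in> M"
    using assms reduces_to_imp_V[OF assms(2)] V_const
    by (intro M_add M_mult) (auto simp: reduces_to_def)
  thus ?thesis
    by (simp add: reduces_to_def ring_hom_mult[OF is_ring_hom_const] algebra_simps)
qed

lemma reduces_to_unique:
  assumes "reduces_to x a" "reduces_to x b"
  shows "a = b"
proof -
  have "const_closure (a - b) + const_closure b = const_closure a"
    by (simp flip: ring_hom_add[OF is_ring_hom_const])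
  hence "const_closure (a - b) = (x - const_closure b) - (x - const_closure a)"
    by (simp add: algebra_simps)
  also have "\<dots> \<in> M"
    using assms unfolding reduces_to_def by (rule M_diff[rotated])
  finally show ?thesis using M_const[of "a - b"] by simp
qed

lemma residue_at_eq: "reduces_to x c \<Longrightarrow> residue_at V x = c"
  unfolding residue_at_def reduces_to_def[symmetric] using reduces_to_unique by blast

lemma reduces_to_poly_closure: "reduces_to (poly_closure p) (poly p t0)"
proof (induction p)
  case 0
  show ?case by (simp add: reduces_to_0_iff M_0 ring_hom_0[OF is_ring_hom_poly_closure])
next
  case (pCons a p)
  thus ?case
    by (simp add: poly_closure_pCons reduces_to_add reduces_to_mult reduces_to_const reduces_to_t)
qed

lemma reduces_to_eval_along:
  assumes "reduces_to z s"
  shows "reduces_to (eval_along poly_closure z G) (poly (poly G [:s:]) t0)"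
proof (induction G)
  case 0
  show ?case by (simp add: reduces_to_0_iff M_0)
next
  case (pCons a G)
  thus ?case
    by (simp add: eval_along_pCons ring_hom_0[OF is_ring_hom_poly_closure] reduces_to_add reduces_to_mult
        reduces_to_poly_closure assms)
qed

text \<open>
  Over the algebraic closure \<open>G\<close> is a constant times a product of linear factors. For a root \<open>z\<close>
  outside the valuation ring, the factor \<open>s - z\<close> is replaced by \<open>1 - s / z\<close>, which has residue 1.
  The constant \<open>c\<close> then left over is not in the maximal ideal, since otherwise all values
  \<open>G(t\<^sub>0, s)\<close> would be 0. As \<open>G\<close> is in the maximal ideal at \<open>s\<^sub>0\<close>, one of the factors is, and it can
  only come from a root with residue \<open>s\<^sub>0\<close>.
\<close>

lemma root_reducing_to:
  assumes G: "poly (poly G [:s0:]) t0 = 0" and nz: "poly (poly G [:s1:]) t0 \<noteq> 0"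
  shows "\<exists>z. eval_along poly_closure z G = 0 \<and> reduces_to z s0"
proof -
  define p where "p = map_poly poly_closure G"
  have p_const: "reduces_to (poly p (const_closure s)) (poly (poly G [:s:]) t0)" for s
    using reduces_to_eval_along[OF reduces_to_const] by (simp add: p_def eval_along_def)
  have "p \<noteq> 0"
  proof
    assume "p = 0"
    hence "reduces_to 0 (poly (poly G [:s1:]) t0)" using p_const[of s1] by simp
    with nz show False
      using reduces_to_unique[of 0 _ 0] by (simp add: reduces_to_0_iff M_0)
  qed
  then obtain A where A: "p = smult (lead_coeff p) (\<Prod>x\<in>#A. [:- x, 1:])"
    using alg_closed_imp_factorization by blast
  define scale where "scale x = (if x \<in> V then 1 else - x)" for x
  define factor where "factor s x = (if x \<in> V then const_closure s - x
                                      else 1 - const_closure s * inverse x)" for s x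
  define c where "c = lead_coeff p * (\<Prod>x\<in>#A. scale x)"
  have factor_V: "factor s x \<in> V" for s x
    unfolding factor_def by (auto intro!: V_diff V_mult V_const V_1 V_inverse)
  have scale_factor: "const_closure s - x = scale x * factor s x" for s x
    using V_0 by (auto simp: scale_def factor_def field_simps)
  have p_eq: "poly p (const_closure s) = c * (\<Prod>x\<in>#A. factor s x)" for s
  proof -
    have "poly p (const_closure s) = lead_coeff p * (\<Prod>x\<in>#A. const_closure s - x)"
      by (subst A) (simp add: poly_prod_mset image_mset.compositionality o_def)
    thus ?thesis
      by (simp add: scale_factor c_def prod_mset.distrib mult_ac)
  qed
  have prod_V: "(\<Prod>x\<in>#A. factor s x) \<in> V" for s
    by (induction A) (auto intro: V_1 V_mult factor_V)
  have "c \<notin> M"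
  proof
    assume "c \<in> M"
    hence "reduces_to (poly p (const_closure s1)) 0"
      using M_mult[OF prod_V] by (simp add: reduces_to_0_iff p_eq mult.commute)
    thus False using nz reduces_to_unique[OF p_const] by blast
  qed
  hence "c \<noteq> 0" "inverse c \<in> V"
    using V_inverse[of c] M_0 by (auto simp: valuation_ideal_def)
  moreover have "poly p (const_closure s0) \<in> M"
    using p_const[of s0] G by (simp add: reduces_to_0_iff)
  ultimately have "inverse c * (c * (\<Prod>x\<in>#A. factor s0 x)) \<in> M"
    unfolding p_eq using M_mult by blast
  hence "(\<Prod>x\<in>#A. factor s0 x) \<in> M"
    using \<open>c \<noteq> 0\<close> by (simp flip: mult.assoc)
  then obtain z where z: "z \<in># A" "factor s0 z \<in> M"
    using M_prime_prod_mset[of A "factor s0"] factor_V by blast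
  have "poly p z = 0"
    using z(1) by (subst A) (auto simp: poly_prod_mset prod_mset_zero_iff)
  moreover have "z \<in> V"
  proof (rule ccontr)
    assume "z \<notin> V"
    hence "inverse z \<in> M" using V_inverse[of z] by (auto simp: valuation_ideal_def)
    moreover have "1 - const_closure s0 * inverse z \<in> M"
      using z(2) \<open>z \<notin> V\<close> by (simp add: factor_def)
    ultimately have "1 \<in> M"
      using M_add[of "1 - const_closure s0 * inverse z" "const_closure s0 * inverse z"]
        M_mult[OF V_const] by simp
    thus False by (simp add: valuation_ideal_def V_1)
  qed
  hence "reduces_to z s0"
    using M_uminus[OF z(2)] by (simp add: factor_def reduces_to_def)
  ultimately show ?thesis
    by (auto simp: p_def eval_along_def)
qed

text \<open>
  The polynomial \<open>g\<close> splits over \<open>F\<close>, and the maximal ideal is prime: one of the linear factors of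
  \<open>g\<close> lies in it at \<open>x\<close>.
\<close>

lemma algebraic_over_constants_reduces:
  assumes "eval_along const_closure x g \<in> M" "g \<noteq> 0" "x \<in> V"
  shows "\<exists>c. reduces_to x c"
  using assms
proof (induction "degree g" arbitrary: g)
  case 0
  then obtain a where "g = [:a:]" "a \<noteq> 0" by (metis degree_0_id degree_eq_zeroE pCons_eq_0_iff)
  thus ?case
    using 0 M_const by (auto simp: eval_along_pCons ring_hom_0[OF is_ring_hom_const])
next
  case (Suc n)
  obtain a where "poly g a = 0"
    using alg_closed_imp_poly_has_root[of g] Suc.hyps by auto
  then obtain h where h: "g = [:- a, 1:] * h"
    by (metis poly_eq_0_iff_dvd dvdE)
  have h0: "h \<noteq> 0" using h Suc.prems by auto
  have neg: "const_closure (- a) = - const_closure a"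
    using ring_hom_add[OF is_ring_hom_const, of a "- a"]
    by (simp add: ring_hom_0[OF is_ring_hom_const] eq_neg_iff_add_eq_0 add.commute)
  have "eval_along const_closure x g = (x - const_closure a) * eval_along const_closure x h"
    unfolding h ring_hom_mult[OF is_ring_hom_eval_along[OF is_ring_hom_const]]
    by (simp add: eval_along_pCons ring_hom_0[OF is_ring_hom_const] ring_hom_1[OF is_ring_hom_const] neg)
  moreover have "eval_along const_closure x h \<in> V"
    by (induction h) (auto simp: eval_along_pCons ring_hom_0[OF is_ring_hom_const]
        intro!: V_0 V_add V_mult V_const Suc.prems)
  ultimately have "x - const_closure a \<in> M \<or> eval_along const_closure x h \<in> M"
    using M_prime Suc.prems V_diff V_const by metis
  moreover have "n = degree h"
    using Suc.hyps(2) h0 unfolding h by (subst (asm) degree_mult_eq) auto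
  ultimately show ?case
    using Suc.hyps(1)[OF _ _ h0 Suc.prems(3)] by (auto simp: reduces_to_def)
qed

lemma eval_along_mod_M:
  assumes "x \<in> V"
  shows "eval_along poly_closure x G - eval_along const_closure x (map_poly (\<lambda>c. poly c t0) G) \<in> M"
proof (induction G)
  case 0
  show ?case by (simp add: M_0)
next
  case (pCons a G)
  have "(poly_closure a - const_closure (poly a t0))
         + x * (eval_along poly_closure x G - eval_along const_closure x (map_poly (\<lambda>c. poly c t0) G)) \<in> M"
    using reduces_to_poly_closure[of a] by (intro M_add M_mult assms pCons.IH) (simp add: reduces_to_def)
  thus ?case
    by (simp add: eval_along_pCons map_poly_pCons ring_hom_0[OF is_ring_hom_poly_closure]
        ring_hom_0[OF is_ring_hom_const] algebra_simps)
qed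

end

lemma clear_denominators:
  fixes p :: "'a::idom fract poly"
  shows "\<exists>d G. d \<noteq> 0 \<and> smult (to_fract d) p = map_poly to_fract G"
proof (induction p)
  case 0
  show ?case by (intro exI[of _ 1] exI[of _ 0]) simp
next
  case (pCons a p)
  then obtain d G where d: "d \<noteq> 0" "smult (to_fract d) p = map_poly to_fract G" by blast
  obtain n m where m: "m \<noteq> 0" "a = to_fract n / to_fract m"
    by (cases a) (auto simp: Fract_conv_to_fract)
  have "smult (to_fract (m * d)) p = smult (to_fract m) (map_poly to_fract G)"
    by (simp flip: d(2))
  hence "smult (to_fract (m * d)) (pCons a p) = map_poly to_fract (pCons (d * n) (smult m G))"
    using m d by (simp add: map_poly_pCons map_poly_smult)
  thus ?case using m d by (metis mult_eq_0_iff)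
qed

lemma algebraic_over_polynomials:
  fixes x :: "'a::field ratfun_closure"
  shows "\<exists>G. G \<noteq> 0 \<and> eval_along poly_closure x G = 0"
proof -
  obtain p :: "'a ratfun poly" where p: "p \<noteq> 0" "poly (map_poly to_ac p) x = 0"
    using alg_closure_algebraic by blast
  obtain d G where d: "d \<noteq> 0" "smult (to_fract d) p = map_poly to_fract G"
    using clear_denominators by blast
  have "map_poly poly_closure G = map_poly to_ac (map_poly to_fract G)"
    by (simp add: map_poly_map_poly o_def poly_closure_def[abs_def])
  also have "\<dots> = smult (to_ac (to_fract d)) (map_poly to_ac p)"
    unfolding d(2)[symmetric] by (simp add: map_poly_smult)
  finally have "eval_along poly_closure x G = 0"
    by (simp add: eval_along_def p)
  moreover have "G \<noteq> 0" using p d by auto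
  ultimately show ?thesis by blast
qed

text \<open>
  While all coefficients of \<open>G\<close> vanish at \<open>t\<^sub>0\<close>, the common factor \<open>t - t\<^sub>0\<close> can be cancelled; this
  lowers the degree of the leading coefficient.
\<close>

lemma remove_content_at:
  fixes G :: "'a::field_char_0 poly poly"
  assumes "G \<noteq> 0" "eval_along poly_closure x G = 0"
  shows "\<exists>H. eval_along poly_closure x H = 0 \<and> map_poly (\<lambda>c. poly c t0) H \<noteq> 0"
  using assms
proof (induction "degree (lead_coeff G)" arbitrary: G rule: less_induct)
  case less
  show ?case
  proof (cases "map_poly (\<lambda>c. poly c t0) G = 0")
    case False
    thus ?thesis using less.prems by blast
  next
    case True
    have "poly (poly.coeff G i) t0 = 0" for i
      using arg_cong[OF True, of "\<lambda>p. poly.coeff p i"] by (simp add: coeff_map_poly)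
    hence "[:[:- t0, 1:]:] dvd G"
      by (simp add: const_poly_dvd_iff poly_eq_0_iff_dvd)
    then obtain H where H: "G = [:[:- t0, 1:]:] * H" by (elim dvdE)
    have H0: "H \<noteq> 0" using H less.prems by auto
    have "eval_along poly_closure x G = poly_closure [:- t0, 1:] * eval_along poly_closure x H"
      unfolding H ring_hom_mult[OF is_ring_hom_eval_along[OF is_ring_hom_poly_closure]]
      by (simp add: eval_along_pCons ring_hom_0[OF is_ring_hom_poly_closure])
    hence "eval_along poly_closure x H = 0"
      using less.prems by (simp add: poly_closure_eq_0_iff)
    moreover have "lead_coeff G = [:- t0, 1:] * lead_coeff H"
      unfolding H by (simp add: lead_coeff_mult)
    hence "degree (lead_coeff H) < degree (lead_coeff G)"
      using H0 by (simp add: degree_mult_eq del: mult_pCons_left)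
    ultimately show ?thesis using less.hyps H0 by blast
  qed
qed

context place
begin

text \<open>
  The residue field is \<open>F\<close>: an element of \<open>V\<close> satisfies an equation over \<open>F[t]\<close> that remains
  nontrivial at \<open>t\<^sub>0\<close>, so its residue is algebraic over the algebraically closed field \<open>F\<close>.
\<close>

lemma V_imp_reduces:
  assumes "x \<in> V"
  shows "\<exists>c. reduces_to x c"
proof -
  obtain G where G: "eval_along poly_closure x G = 0" "map_poly (\<lambda>c. poly c t0) G \<noteq> 0"
    using algebraic_over_polynomials remove_content_at by metis
  have "eval_along const_closure x (map_poly (\<lambda>c. poly c t0) G) \<in> M"
    using M_uminus[OF eval_along_mod_M[OF assms, of G]] G(1) by simp
  thus ?thesis
    using algebraic_over_constants_reduces G(2) assms by blast
qed

end

section \<open>Substitution into a plane curve\<close>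

lemma finite_coeff_support: "finite {i + j | i j. poly.coeff (poly.coeff f j) i \<noteq> 0}"
proof -
  have "{i + j | i j. poly.coeff (poly.coeff f j) i \<noteq> 0}
        \<subseteq> (\<Union>j\<le>degree f. \<Union>i\<le>degree (poly.coeff f j). {i + j})"
    by (fastforce intro: le_degree)
  thus ?thesis by (rule finite_subset) simp
qed

lemma coeff_imp_le_curve_degree:
  "poly.coeff (poly.coeff f j) i \<noteq> 0 \<Longrightarrow> i + j \<le> curve_degree f"
  unfolding curve_degree_def by (rule Max_ge[OF finite_coeff_support]) blast

text \<open>
  The polynomial \<open>f\<close> at a point with coordinates in a ring over \<open>F\<close>, via \<open>h\<close>. Written as a sum over
  the monomials of degree up to the degree of \<open>f\<close>, it can be compared term by term with the
  homogenization of \<open>f\<close>.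
\<close>

definition subst2 :: "('a::comm_ring_1 \<Rightarrow> 'b::comm_ring_1) \<Rightarrow> 'a poly poly \<Rightarrow> 'b \<Rightarrow> 'b \<Rightarrow> 'b" where
  "subst2 h f x y =
     (\<Sum>j\<le>curve_degree f. \<Sum>i\<le>curve_degree f - j. h (poly.coeff (poly.coeff f j) i) * x ^ i * y ^ j)"

lemma ring_hom_subst2:
  assumes "is_ring_hom g"
  shows "g (subst2 h f x y) = subst2 (\<lambda>c. g (h c)) f (g x) (g y)"
  by (simp add: subst2_def ring_hom_sum[OF assms] ring_hom_mult[OF assms] ring_hom_power[OF assms])

lemma poly_eq_sum: "degree p \<le> n \<Longrightarrow> poly p (x :: 'a::comm_ring_1) = (\<Sum>i\<le>n. poly.coeff p i * x ^ i)"
  unfolding poly_altdef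
  by (rule sum.mono_neutral_left) (auto simp: coeff_eq_0)

lemma eval2_eq_subst2: "eval2 f p = subst2 (\<lambda>c. c) f (p $ 1) (p $ 2)"
proof -
  have dj: "degree (poly.coeff f j) \<le> curve_degree f - j" for j
  proof (rule degree_le, clarify)
    fix i assume "curve_degree f - j < i"
    thus "poly.coeff (poly.coeff f j) i = 0"
      using coeff_imp_le_curve_degree[of f j i] by fastforce
  qed
  have d: "degree f \<le> curve_degree f"
  proof (rule degree_le, clarify)
    fix j assume "curve_degree f < j"
    thus "poly.coeff f j = 0"
      using coeff_imp_le_curve_degree[of f j] by (intro poly_eqI) fastforce
  qed
  show ?thesis
    unfolding eval2_def subst2_def
    by (simp add: poly_eq_sum[OF d] poly_sum poly_eq_sum[OF dj] sum_distrib_right)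
qed

text \<open>
  In \<open>F[t][s]\<close> the parameter \<open>t\<close> of a pencil of lines is the inner variable and the parameter \<open>s\<close>
  on a line is the outer one.
\<close>

abbreviation const2 :: "'a::comm_ring_1 \<Rightarrow> 'a poly poly" where
  "const2 c \<equiv> [:[:c:]:]"

abbreviation eval_ts :: "'a::comm_ring_1 \<Rightarrow> 'a \<Rightarrow> 'a poly poly \<Rightarrow> 'a" where
  "eval_ts t s P \<equiv> poly (poly P [:s:]) t"

lemma eval_ts_subst2: "eval_ts t s (subst2 const2 f U W) = subst2 (\<lambda>c. c) f (eval_ts t s U) (eval_ts t s W)"
  by (simp add: ring_hom_subst2[OF is_ring_hom_eval])

context place
begin

lemma reduces_to_subst2:
  assumes "reduces_to x a" "reduces_to y b"
  shows "reduces_to (subst2 const_closure f x y) (subst2 (\<lambda>c. c) f a b)"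
proof -
  have sum: "reduces_to (\<Sum>i\<in>A. u i) (\<Sum>i\<in>A. v i)" if "\<And>i. reduces_to (u i) (v i)" for A :: "nat set" and u v
    by (induction A rule: infinite_finite_induct)
       (auto intro: reduces_to_add that simp: reduces_to_0_iff M_0)
  have one: "reduces_to 1 1"
    using reduces_to_const[of 1] by (simp add: ring_hom_1[OF is_ring_hom_const])
  have pow: "reduces_to (u ^ n) (c ^ n)" if "reduces_to u c" for u c n
    by (induction n) (auto intro: reduces_to_mult that one)
  show ?thesis
    unfolding subst2_def by (intro sum reduces_to_mult pow reduces_to_const assms)
qed

lemma value_at_eq:
  fixes P :: "'a ratfun_closure ^ 'n::finite" and Q :: "'a ^ 'n"
  assumes "\<And>i. reduces_to (P $ i) (Q $ i)"
  shows "defined_at V P" "value_at V P = Q"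
  using reduces_to_imp_V[OF assms] residue_at_eq[OF assms]
  by (auto simp: defined_at_def value_at_def vec_eq_iff)

text \<open>A point of the curve over the closure of \<open>F(t)\<close> specializes to a point of the curve over \<open>F\<close>.\<close>

lemma value_at_in_curve:
  fixes P :: "'a ratfun_closure ^ 2"
  assumes "subst2 const_closure f (P $ 1) (P $ 2) = 0" "defined_at V P"
  shows "value_at V P \<in> affine_curve f"
proof -
  have "\<exists>c. reduces_to (P $ i) c" for i
    using V_imp_reduces assms(2) by (auto simp: defined_at_def)
  then obtain c where c: "\<And>i. reduces_to (P $ i) (c i)" by metis
  have "reduces_to 0 (subst2 (\<lambda>c. c) f (c 1) (c 2))"
    using reduces_to_subst2[OF c c, of f 1 2] assms(1) by simp
  hence "subst2 (\<lambda>c. c) f (c 1) (c 2) = 0"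
    using reduces_to_unique[of 0 _ 0] by (simp add: reduces_to_0_iff M_0)
  thus ?thesis
    using value_at_eq(2)[of P "\<chi> i. c i"] c by (simp add: affine_curve_def eval2_eq_subst2)
qed

end

lemma inj_const_closure: "inj const_closure"
  by (auto intro!: injI simp: const_closure_def)

lemma eval_along_in_subfield:
  assumes "is_subfield L" "range to_ac \<subseteq> L" "z \<in> L"
  shows "eval_along poly_closure z P \<in> L"
proof (induction P)
  case 0
  show ?case using assms(2) to_ac_0 by (metis eval_along_0 range_subsetD)
next
  case (pCons a P)
  moreover have "poly_closure a \<in> L"
    using assms(2) by (auto simp: poly_closure_def)
  ultimately show ?case
    using assms(1,3)
    by (simp add: eval_along_pCons ring_hom_0[OF is_ring_hom_poly_closure] is_subfield_def)
qed

lemma coordinates_in_root_tower: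
  fixes G :: "'a::field_char_0 poly poly" and P :: "'a ratfun_closure ^ 'n::finite"
  assumes "G \<noteq> 0" "degree G \<le> 4" "eval_along poly_closure z G = 0"
    and "\<And>i. \<exists>U. P $ i = eval_along poly_closure z U"
  shows "\<exists>g s Ks. root_tower g s Ks \<and> (\<forall>i. P $ i \<in> Ks s)"
proof -
  let ?g = "map_poly to_fract G"
  have "?g \<noteq> 0" "degree ?g \<le> 4"
    using assms(1,2) by (auto simp: map_poly_eq_0_iff degree_map_poly)
  then obtain s Ks where Ks: "root_tower ?g s Ks" "is_subfield (Ks s)"
    using degree_le_4_root_tower by blast
  have "map_poly to_ac ?g = map_poly poly_closure G"
    by (simp add: map_poly_map_poly o_def poly_closure_def[abs_def])
  hence "range to_ac \<union> {z} \<subseteq> splitting_field_in (range to_ac) (map_poly to_ac ?g)"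
    using assms(3) by (auto simp: splitting_field_in_def eval_along_def intro!: generate_field.incl)
  also have "\<dots> \<subseteq> Ks s"
    using Ks(1) by (simp add: root_tower_def)
  finally have "range to_ac \<subseteq> Ks s" "z \<in> Ks s" by auto
  hence "P $ i \<in> Ks s" for i
    using eval_along_in_subfield[OF Ks(2)] assms(4) by metis
  thus ?thesis using Ks(1) by blast
qed

text \<open>
  The pairs \<open>(U, W)\<close> give for each \<open>t\<close> a curve with parameter \<open>s\<close>, in the applications a line, and
  \<open>G\<close> selects points on it that lie on \<open>f = 0\<close>. The roots \<open>z\<close> of \<open>G\<close> give the parametrizations
  \<open>(U(z), W(z))\<close>. A root for which both coordinates are constant does not give a square
  parametrization, but it would account for one point only, and such points are left to the finite
  exceptional set.
\<close>

theorem soluble_if_swept_out_in_degree_le_4: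
  fixes f G U W :: "'a::{alg_closed_field, field_char_0} poly poly"
  assumes places: "\<And>t0. place_at t0 (Pl t0)"
    and G: "G dvd subst2 const2 f U W" "degree G \<le> 4"
    and nz: "\<And>t. \<exists>s. eval_ts t s G \<noteq> 0"
    and hit: "finite {Q \<in> affine_curve f. \<not> (\<exists>t s. eval_ts t s G = 0 \<and>
                Q $ 1 = eval_ts t s U \<and> Q $ 2 = eval_ts t s W)}" (is "finite ?missed")
  shows "soluble_by_radicals Pl (affine_curve f)"
proof -
  interpret place t0 "Pl t0" for t0 by (rule place.intro) (rule places)
  define ev where "ev z = eval_along (poly_closure :: 'a poly \<Rightarrow> _) z" for z
  define point where "point z = (\<chi> i. if i = 1 then ev z U else ev z W :: 'a ratfun_closure ^ 2)" for z
  define Z where "Z = {z. ev z G = 0}"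
  define \<P> where "\<P> = {P \<in> point ` Z. square_parametrization P}"
  have G0: "G \<noteq> 0" using nz by auto
  have hom: "is_ring_hom (ev z)" for z
    unfolding ev_def by (intro is_ring_hom_eval_along is_ring_hom_poly_closure)
  have point_1: "point z $ 1 = ev z U" and point_2: "point z $ 2 = ev z W" for z
    by (simp_all add: point_def)
  have ev_const: "ev z (const2 c) = const_closure c" for z c
    by (simp add: ev_def eval_along_pCons ring_hom_0[OF is_ring_hom_poly_closure]
        const_closure_eq_poly_closure)
  have "map_poly poly_closure G \<noteq> 0"
    using G0 by (simp add: map_poly_eq_0_iff poly_closure_eq_0_iff)
  hence Z: "finite Z"
    using poly_roots_finite by (simp add: Z_def ev_def eval_along_def)
  have on_curve: "subst2 const_closure f (point z $ 1) (point z $ 2) = 0" if z: "z \<in> Z" for z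
  proof -
    obtain H where H: "subst2 const2 f U W = G * H" using G(1) by (elim dvdE)
    have "ev z (subst2 const2 f U W) = 0"
      unfolding H using z by (simp add: ring_hom_mult[OF hom] Z_def)
    thus ?thesis
      by (simp add: ring_hom_subst2[OF hom] ev_const point_1 point_2)
  qed
  \<comment> \<open>The points that correspond to roots with constant coordinates.\<close>
  define exceptional where "exceptional = (\<lambda>z. \<chi> i. inv_into UNIV const_closure (point z $ i)) ` Z"
  have reached: "Q \<in> exceptional \<or> (\<exists>t0. \<exists>P\<in>\<P>. defined_at (Pl t0) P \<and> Q = value_at (Pl t0) P)"
    if Q: "Q \<in> affine_curve f" "Q \<notin> ?missed" for Q
  proof -
    obtain t0 s0 where ts: "eval_ts t0 s0 G = 0" "Q $ 1 = eval_ts t0 s0 U" "Q $ 2 = eval_ts t0 s0 W"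
      using Q by blast
    obtain s1 where "eval_ts t0 s1 G \<noteq> 0" using nz by blast
    then obtain z where z: "ev z G = 0" "reduces_to t0 z s0"
      using root_reducing_to ts(1) unfolding ev_def by blast
    have red: "reduces_to t0 (point z $ i) (Q $ i)" for i
      using ts reduces_to_eval_along[OF z(2)] exhaust_2[of i]
      by (auto simp: point_1 point_2 ev_def)
    show ?thesis
    proof (cases "\<forall>i. point z $ i \<in> range const_closure")
      case True
      have "inv_into UNIV const_closure (point z $ i) = Q $ i" for i
      proof -
        obtain c where c: "point z $ i = const_closure c" using True by blast
        have "c = Q $ i"
          using red[of i] reduces_to_const unfolding c by (rule reduces_to_unique[rotated])
        thus ?thesis unfolding c by (simp add: inv_f_f[OF inj_const_closure])
      qed
      hence "Q = (\<chi> i. inv_into UNIV const_closure (point z $ i))" by (simp add: vec_eq_iff)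
      \<comment> \<open>A constant coordinate is its own value, so \<open>Q\<close> is the only point accounted for by \<open>z\<close>.\<close>
      thus ?thesis using z(1) by (auto simp: exceptional_def Z_def)
    next
      case False
      have "\<exists>H. point z $ i = eval_along poly_closure z H" for i
        using exhaust_2[of i] by (auto simp: point_1 point_2 ev_def)
      hence "square_parametrization (point z)"
        using coordinates_in_root_tower[OF G0 G(2)] z(1) False
        unfolding square_parametrization_def ev_def by blast
      hence "point z \<in> \<P>" using z(1) by (auto simp: \<P>_def Z_def)
      thus ?thesis using value_at_eq[OF red] by blast
    qed
  qed
  have "finite (?missed \<union> exceptional)"
    using hit Z by (simp add: exceptional_def)
  hence "finite {Q \<in> affine_curve f.
      \<not> (\<exists>t0. \<exists>P\<in>\<P>. defined_at (Pl t0) P \<and> Q = value_at (Pl t0) P)}"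
    by (rule rev_finite_subset) (use reached in blast)
  moreover have "finite \<P>" using Z by (simp add: \<P>_def)
  moreover have "value_at (Pl t0) P \<in> affine_curve f" if "P \<in> \<P>" "defined_at (Pl t0) P" for P t0
    using that on_curve value_at_in_curve by (auto simp: \<P>_def)
  ultimately show ?thesis
    unfolding soluble_by_radicals_def by (intro exI[of _ \<P>]) (auto simp: \<P>_def)
qed

lemma subst2_id: "subst2 (\<lambda>c. c) f x y = poly (poly f [:y:]) x"
  using eval2_eq_subst2[of f "\<chi> i. if i = 1 then x else y"] by (simp add: eval2_def)

lemma finite_on_vertical_line:
  fixes f :: "'a::{idom, ring_char_0} poly poly"
  assumes "poly (poly f [:y:]) a \<noteq> 0"
  shows "finite {Q \<in> affine_curve f. Q $ 1 = a}"
proof -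
  define q where "q = map_poly (\<lambda>c. poly c a) f"
  have q: "poly (poly f [:y:]) a = poly q y" for y
    unfolding q_def by (induction f) (simp_all add: map_poly_pCons)
  hence "q \<noteq> 0" using assms by auto
  hence "finite {y. poly q y = 0}" by (rule poly_roots_finite)
  moreover have "{Q \<in> affine_curve f. Q $ 1 = a} \<subseteq> (\<lambda>y. \<chi> i. if i = 1 then a else y) ` {y. poly q y = 0}"
  proof
    fix Q assume "Q \<in> {Q \<in> affine_curve f. Q $ 1 = a}"
    hence Q: "poly (poly f [:Q $ 2:]) (Q $ 1) = 0" "Q $ 1 = a"
      by (auto simp: affine_curve_def eval2_def)
    have "poly q (Q $ 2) = 0" "Q = (\<chi> i. if i = 1 then a else Q $ 2)"
      using Q q[of "Q $ 2"] by (simp_all add: vec_eq_iff forall_2)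
    thus "Q \<in> (\<lambda>y. \<chi> i. if i = 1 then a else y) ` {y. poly q y = 0}" by blast
  qed
  ultimately show ?thesis by (meson finite_imageI finite_subset)
qed

section \<open>Curves that contain a line\<close>

text \<open>Here \<open>G = s\<close> has the root 0 only, and \<open>U\<close> and \<open>W\<close> do not involve \<open>s\<close>.\<close>

lemma soluble_if_polynomially_parametrized:
  fixes x y :: "'a::{alg_closed_field, field_char_0} poly"
  assumes places: "\<And>t0. place_at t0 (Pl t0)"
    and curve: "affine_curve f = {Q. \<exists>t. Q $ 1 = poly x t \<and> Q $ 2 = poly y t}"
  shows "soluble_by_radicals Pl (affine_curve f)"
proof (rule soluble_if_swept_out_in_degree_le_4[OF places])
  have "poly (poly (subst2 const2 f [:x:] [:y:]) 0) t = 0" for t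
  proof -
    have "(\<chi> i. if i = 1 then poly x t else poly y t) \<in> affine_curve f"
      unfolding curve by auto
    thus ?thesis
      using eval_ts_subst2[where f = f and U = "[:x:]" and W = "[:y:]" and s = 0 and t = t] by (simp add: affine_curve_def eval2_eq_subst2)
  qed
  hence "poly (subst2 const2 f [:x:] [:y:]) 0 = 0"
    using poly_all_0_iff_0 by blast
  thus "[:0, 1:] dvd subst2 const2 f [:x:] [:y:]"
    using poly_eq_0_iff_dvd[of "subst2 const2 f [:x:] [:y:]" 0] by simp
  show "\<exists>s. eval_ts t s [:0, 1:] \<noteq> 0" for t :: 'a
    by (rule exI[of _ 1]) simp
  have "{Q \<in> affine_curve f. \<not> (\<exists>t s. eval_ts t s [:0, 1:] = 0 \<and>
          Q $ 1 = eval_ts t s [:x:] \<and> Q $ 2 = eval_ts t s [:y:])} = {}"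
    unfolding curve by fastforce
  thus "finite {Q \<in> affine_curve f. \<not> (\<exists>t s. eval_ts t s [:0, 1:] = 0 \<and>
          Q $ 1 = eval_ts t s [:x:] \<and> Q $ 2 = eval_ts t s [:y:])}"
    by (simp only: finite.emptyI)
qed simp

text \<open>
  An irreducible polynomial that vanishes on a line is a constant multiple of the equation of the
  line.
\<close>

lemma soluble_if_contains_graph:
  fixes f :: "'a::{alg_closed_field, field_char_0} poly poly"
  assumes places: "\<And>t0. place_at t0 (Pl t0)"
    and f: "Factorial_Ring.irreducible f" "\<And>x. poly (poly f [:k + m * x:]) x = 0"
  shows "soluble_by_radicals Pl (affine_curve f)"
proof -
  have "poly (poly f [:k, m:]) x = 0" for x
  proof -
    have "poly (poly f q) x = poly (poly f [:poly q x:]) x" for q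
      by (induction f) simp_all
    from this[of "[:k, m:]"] show ?thesis using f(2)[of x] by (simp add: mult.commute)
  qed
  hence "poly f [:k, m:] = 0" using poly_all_0_iff_0 by blast
  then obtain h where h: "f = [:- [:k, m:], 1:] * h"
    unfolding poly_eq_0_iff_dvd by (elim dvdE)
  have "\<not> [:- [:k, m:], 1:] dvd (1 :: 'a poly poly)"
    by (auto simp: is_unit_poly_iff)
  hence "h dvd 1"
    using irreducibleD[OF f(1) h] by blast
  then obtain c where c: "h = const2 c" "c dvd 1"
    by (auto simp: is_unit_poly_iff)
  hence "c \<noteq> 0" by auto
  have "poly (poly f [:y:]) x = (y - k - m * x) * c" for x y
    by (simp add: h c algebra_simps)
  hence "affine_curve f = {Q. \<exists>t. Q $ 1 = poly [:0, 1:] t \<and> Q $ 2 = poly [:k, m:] t}"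
    unfolding affine_curve_def eval2_def using \<open>c \<noteq> 0\<close>
    by (simp only: mult_eq_0_iff) (auto simp: diff_diff_eq mult.commute)
  thus ?thesis by (rule soluble_if_polynomially_parametrized[OF places])
qed

lemma soluble_if_contains_vertical_line:
  fixes f :: "'a::{alg_closed_field, field_char_0} poly poly"
  assumes places: "\<And>t0. place_at t0 (Pl t0)"
    and f: "Factorial_Ring.irreducible f" "\<And>y. poly (poly f [:y:]) a = 0"
  shows "soluble_by_radicals Pl (affine_curve f)"
proof -
  have "poly (poly f [:y:]) a = poly (map_poly (\<lambda>c. poly c a) f) y" for y
    by (induction f) (simp_all add: map_poly_pCons)
  hence "map_poly (\<lambda>c. poly c a) f = 0"
    using f(2) poly_all_0_iff_0 by metis
  hence "poly (poly.coeff f i) a = 0" for i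
    using coeff_map_poly[of "\<lambda>c. poly c a" f i] by simp
  hence "[:[:- a, 1:]:] dvd f"
    by (simp add: const_poly_dvd_iff poly_eq_0_iff_dvd)
  then obtain h where h: "f = [:[:- a, 1:]:] * h" by (elim dvdE)
  have "\<not> [:[:- a, 1:]:] dvd (1 :: 'a poly poly)"
    by (auto simp: is_unit_poly_iff)
  hence "h dvd 1"
    using irreducibleD[OF f(1) h] by blast
  then obtain c where c: "h = const2 c" "c dvd 1"
    by (auto simp: is_unit_poly_iff)
  hence "c \<noteq> 0" by auto
  have "poly (poly f [:y:]) x = (x - a) * c" for x y
    by (simp add: h c algebra_simps)
  hence "affine_curve f = {Q. \<exists>t. Q $ 1 = poly [:a:] t \<and> Q $ 2 = poly [:0, 1:] t}"
    unfolding affine_curve_def eval2_def using \<open>c \<noteq> 0\<close> by auto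
  thus ?thesis by (rule soluble_if_polynomially_parametrized[OF places])
qed

section \<open>Homogenization\<close>

text \<open>The homogenization of \<open>f\<close> at a point with homogeneous coordinates in a ring over \<open>F\<close>.\<close>

definition subst3 :: "('a::comm_ring_1 \<Rightarrow> 'b::comm_ring_1) \<Rightarrow> 'a poly poly \<Rightarrow> 'b \<Rightarrow> 'b \<Rightarrow> 'b \<Rightarrow> 'b" where
  "subst3 h f x y z = (\<Sum>j\<le>curve_degree f. \<Sum>i\<le>curve_degree f - j.
     h (poly.coeff (poly.coeff f j) i) * (x ^ i * y ^ j * z ^ (curve_degree f - i - j)))"

lemma subst3_1: "subst3 h f x y 1 = subst2 h f x y"
  by (simp add: subst3_def subst2_def mult.assoc)

abbreviation mon3 :: "'a::comm_ring_1 \<Rightarrow> nat \<Rightarrow> nat \<Rightarrow> nat \<Rightarrow> 'a poly poly poly" where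
  "mon3 c i j k \<equiv> Polynomial.monom (Polynomial.monom (Polynomial.monom c i) j) k"

lemma eval3_sum: "eval3 (sum H A) p = (\<Sum>x\<in>A. eval3 (H x) p)"
  by (simp add: eval3_def poly_sum)

lemma map_poly_sum:
  assumes "g 0 = 0" "\<And>x y. g (x + y) = g x + g y"
  shows "map_poly g (sum H A) = (\<Sum>x\<in>A. map_poly g (H x))"
proof -
  have "map_poly g (p + q) = map_poly g p + map_poly g q" for p q
    by (intro poly_eqI) (simp add: coeff_map_poly assms)
  thus ?thesis
    by (induction A rule: infinite_finite_induct) simp_all
qed

lemma map_poly_monom: "g 0 = 0 \<Longrightarrow> map_poly g (Polynomial.monom c n) = Polynomial.monom (g c) n"
  by (intro poly_eqI) (simp add: coeff_map_poly)

lemma pderiv_sum': "pderiv (sum H A) = (\<Sum>x\<in>A. pderiv (H x))"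
  by (induction A rule: infinite_finite_induct) (simp_all add: pderiv_add)

lemma partial_X_sum: "partial_X (sum H A) = (\<Sum>x\<in>A. partial_X (H x))"
  unfolding partial_X_def
  by (rule map_poly_sum) (simp, intro poly_eqI, simp add: coeff_map_poly pderiv_add)

lemma partial_Y_sum: "partial_Y (sum H A) = (\<Sum>x\<in>A. partial_Y (H x))"
  unfolding partial_Y_def by (rule map_poly_sum) (simp_all add: pderiv_add)

lemma partial_Z_sum: "partial_Z (sum H A) = (\<Sum>x\<in>A. partial_Z (H x))"
  unfolding partial_Z_def by (rule pderiv_sum')

lemma eval3_mon3: "eval3 (mon3 c i j k) p = c * (p $ 1 ^ i * p $ 2 ^ j * p $ 3 ^ k)"
  by (simp add: eval3_def poly_monom mult_ac)

lemma eval3_partial_X_mon3: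
  "eval3 (partial_X (mon3 c i j k)) p = c * (of_nat i * p $ 1 ^ (i - 1) * p $ 2 ^ j * p $ 3 ^ k)"
  by (simp add: eval3_def partial_X_def map_poly_monom pderiv_monom poly_monom mult_ac)

lemma eval3_partial_Y_mon3:
  "eval3 (partial_Y (mon3 c i j k)) p = c * (p $ 1 ^ i * (of_nat j * p $ 2 ^ (j - 1)) * p $ 3 ^ k)"
  by (simp add: eval3_def partial_Y_def map_poly_monom pderiv_monom poly_monom mult_ac)

lemma eval3_partial_Z_mon3:
  "eval3 (partial_Z (mon3 c i j k)) p = c * (p $ 1 ^ i * p $ 2 ^ j * (of_nat k * p $ 3 ^ (k - 1)))"
  by (simp add: eval3_def partial_Z_def pderiv_monom poly_monom mult_ac)

lemmas eval3_homogenization_simps = homogenization_def Let_def eval3_sum partial_X_sum partial_Y_sum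
  partial_Z_sum eval3_mon3 eval3_partial_X_mon3 eval3_partial_Y_mon3 eval3_partial_Z_mon3

text \<open>
  The homogenization is homogeneous of degree \<open>d\<close>, and its partial derivatives are homogeneous of
  degree \<open>d - 1\<close>. The derivatives are compared after multiplication by \<open>c\<close>, since \<open>d - 1\<close> would be
  truncated for \<open>d = 0\<close>.
\<close>

lemma singular_point_scale:
  fixes f :: "'a::field poly poly"
  assumes "singular_point_of_projective_closure f p" "c \<noteq> 0"
  shows "singular_point_of_projective_closure f (\<chi> i. c * p $ i)"
proof -
  define d where "d = curve_degree f"
  define H where "H = homogenization f"
  let ?q = "\<chi> i. c * p $ i"
  let ?p1 = "p $ 1" and ?p2 = "p $ 2" and ?p3 = "p $ 3" and ?q1 = "?q $ 1" and ?q2 = "?q $ 2" and ?q3 = "?q $ 3"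
  have deriv: "c * (of_nat n * (c * x) ^ (n - 1)) = c ^ n * (of_nat n * x ^ (n - 1))" for x :: 'a and n
    by (cases n) (simp_all add: power_mult_distrib mult_ac)
  have pull: "c * (k * (D' * y * z)) = m * (k * (D * y * z))"
      "c * (k * (y * D' * z)) = m * (k * (y * D * z))"
      "c * (k * (y * z * D')) = m * (k * (y * z * D))"
    if "c * D' = m * D" for k m y z D D' :: 'a
  proof -
    have "(c * D') * (k * y * z) = (m * D) * (k * y * z)" by (simp only: that)
    thus "c * (k * (D' * y * z)) = m * (k * (D * y * z))"
      "c * (k * (y * D' * z)) = m * (k * (y * D * z))"
      "c * (k * (y * z * D')) = m * (k * (y * z * D))"
      by (simp_all add: mult_ac)
  qed
  have split: "c ^ d = c ^ i * c ^ j * c ^ (d - i - j)" if "j \<le> d" "i \<le> d - j" for i j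
    using that by (simp flip: power_add)
  have "eval3 H ?q = c ^ d * eval3 H p"
    unfolding H_def eval3_homogenization_simps d_def[symmetric] sum_distrib_left
    by (intro sum.cong refl) (simp add: split power_mult_distrib mult_ac)
  moreover have "c * eval3 (partial_X H) ?q = c ^ d * eval3 (partial_X H) p"
    unfolding H_def eval3_homogenization_simps d_def[symmetric] sum_distrib_left
  proof (intro sum.cong refl)
    fix i j assume ij: "j \<in> {..d}" "i \<in> {..d - j}"
    show "c * (poly.coeff (poly.coeff f j) i * (of_nat i * ?q1 ^ (i - 1) * ?q2 ^ j * ?q3 ^ (d - i - j)))
            = c ^ d * (poly.coeff (poly.coeff f j) i * (of_nat i * ?p1 ^ (i - 1) * ?p2 ^ j * ?p3 ^ (d - i - j)))"
      unfolding vec_lambda_beta pull(1)[OF deriv[of i "p $ 1"]]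
      using ij by (simp add: split power_mult_distrib mult_ac)
  qed
  moreover have "c * eval3 (partial_Y H) ?q = c ^ d * eval3 (partial_Y H) p"
    unfolding H_def eval3_homogenization_simps d_def[symmetric] sum_distrib_left
  proof (intro sum.cong refl)
    fix i j assume ij: "j \<in> {..d}" "i \<in> {..d - j}"
    show "c * (poly.coeff (poly.coeff f j) i * (?q1 ^ i * (of_nat j * ?q2 ^ (j - 1)) * ?q3 ^ (d - i - j)))
            = c ^ d * (poly.coeff (poly.coeff f j) i * (?p1 ^ i * (of_nat j * ?p2 ^ (j - 1)) * ?p3 ^ (d - i - j)))"
      unfolding vec_lambda_beta pull(2)[OF deriv[of j "p $ 2"]]
      using ij by (simp add: split power_mult_distrib mult_ac)
  qed
  moreover have "c * eval3 (partial_Z H) ?q = c ^ d * eval3 (partial_Z H) p"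
    unfolding H_def eval3_homogenization_simps d_def[symmetric] sum_distrib_left
  proof (intro sum.cong refl)
    fix i j assume ij: "j \<in> {..d}" "i \<in> {..d - j}"
    show "c * (poly.coeff (poly.coeff f j) i * (?q1 ^ i * ?q2 ^ j * (of_nat (d - i - j) * ?q3 ^ (d - i - j - 1))))
            = c ^ d * (poly.coeff (poly.coeff f j) i * (?p1 ^ i * ?p2 ^ j * (of_nat (d - i - j) * ?p3 ^ (d - i - j - 1))))"
      unfolding vec_lambda_beta pull(3)[OF deriv[of "d - i - j" "p $ 3"]]
      using ij by (simp add: split power_mult_distrib mult_ac)
  qed
  ultimately show ?thesis
    using assms unfolding singular_point_of_projective_closure_def H_def Let_def
    by (auto simp: vec_eq_iff)
qed

section \<open>Restriction to a line through a singular point\<close>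

text \<open>
  \<open>p\<close> and \<open>q\<close> are the two dehomogenizations of a binary form of degree \<open>d\<close>. Vanishing of the highest
  coefficients of one thereby follows from vanishing of the lowest coefficients of the other; this
  covers points at infinity.
\<close>

definition mirrored :: "nat \<Rightarrow> 'a::zero poly \<Rightarrow> 'a poly \<Rightarrow> bool" where
  "mirrored d p q \<longleftrightarrow> (\<forall>n>d. poly.coeff p n = 0 \<and> poly.coeff q n = 0) \<and>
     (\<forall>n\<le>d. poly.coeff q n = poly.coeff p (d - n))"

lemma mirrored_linear_mult:
  assumes "mirrored d p q"
  shows "mirrored (Suc d) ([:a, v:] * p) ([:v, a:] * q)"
proof -
  have coeff: "poly.coeff ([:x, y:] * r) n = x * poly.coeff r n + (case n of 0 \<Rightarrow> 0 | Suc m \<Rightarrow> y * poly.coeff r m)"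
    for x y :: 'a and r n by (simp add: coeff_pCons split: nat.split)
  have "poly.coeff ([:v, a:] * q) n = poly.coeff ([:a, v:] * p) (Suc d - n)" if "n \<le> Suc d" for n
  proof (cases n)
    case 0
    thus ?thesis using assms by (simp add: mirrored_def coeff)
  next
    case (Suc m)
    show ?thesis
    proof (cases "m = d")
      case True
      thus ?thesis using assms Suc by (simp add: mirrored_def coeff)
    next
      case False
      with Suc that have "d - m = Suc (d - Suc m)" "m < d" by auto
      thus ?thesis
        using assms Suc unfolding coeff by (simp add: mirrored_def add.commute)
    qed
  qed
  moreover have "poly.coeff ([:a, v:] * p) n = 0" "poly.coeff ([:v, a:] * q) n = 0" if "n > Suc d" for n
    using assms that unfolding coeff by (auto simp: mirrored_def split: nat.split)
  ultimately show ?thesis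
    by (simp only: mirrored_def) blast
qed

lemma mirrored_linear_power_mult:
  "mirrored d p q \<Longrightarrow> mirrored (n + d) ([:a, v:] ^ n * p) ([:v, a:] ^ n * q)"
  by (induction n) (auto simp only: power_0 power_Suc mult.assoc mult_1 add_0 add_Suc mirrored_linear_mult)

lemma mirrored_monomial:
  "mirrored (i + j + k) ([:a, v:] ^ i * [:b, w:] ^ j * [:c, u:] ^ k) ([:v, a:] ^ i * [:w, b:] ^ j * [:u, c:] ^ k)"
proof -
  have "mirrored 0 1 1" by (simp add: mirrored_def coeff_1)
  hence "mirrored (i + (j + (k + 0)))
     ([:a, v:] ^ i * ([:b, w:] ^ j * ([:c, u:] ^ k * 1))) ([:v, a:] ^ i * ([:w, b:] ^ j * ([:u, c:] ^ k * 1)))"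
    by (intro mirrored_linear_power_mult)
  thus ?thesis by (simp add: mult.assoc add.assoc)
qed

lemma mirrored_smult: "mirrored d p q \<Longrightarrow> mirrored d (smult c p) (smult c q)"
  by (simp add: mirrored_def)

lemma mirrored_sum: "(\<And>x. x \<in> A \<Longrightarrow> mirrored d (p x) (q x)) \<Longrightarrow> mirrored d (sum p A) (sum q A)"
  by (simp add: mirrored_def coeff_sum)

lemma mirrored_subst3:
  "mirrored (curve_degree f) (subst3 (\<lambda>c. [:h c:]) f [:a, v:] [:b, w:] [:c, u:])
     (subst3 (\<lambda>c. [:h c:]) f [:v, a:] [:w, b:] [:u, c:])"
  unfolding subst3_def
proof (intro mirrored_sum)
  fix i j assume "j \<in> {..curve_degree f}" "i \<in> {..curve_degree f - j}"
  hence k: "i + j + (curve_degree f - i - j) = curve_degree f" by simp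
  show "mirrored (curve_degree f)
     ([:h (poly.coeff (poly.coeff f j) i):] * ([:a, v:] ^ i * [:b, w:] ^ j * [:c, u:] ^ (curve_degree f - i - j)))
     ([:h (poly.coeff (poly.coeff f j) i):] * ([:v, a:] ^ i * [:w, b:] ^ j * [:u, c:] ^ (curve_degree f - i - j)))"
    using mirrored_smult[OF mirrored_monomial[of i j "curve_degree f - i - j" a v b w c u]]
    unfolding k by simp
qed

lemma coeff_linear_power:
  fixes a v :: "'a::comm_ring_1"
  shows "poly.coeff ([:a, v:] ^ n) 0 = a ^ n"
    and "poly.coeff ([:a, v:] ^ n) 1 = of_nat n * a ^ (n - 1) * v"
proof -
  show 0: "poly.coeff ([:a, v:] ^ n) 0 = a ^ n" for n
    by (simp add: coeff_0_power)
  show "poly.coeff ([:a, v:] ^ n) 1 = of_nat n * a ^ (n - 1) * v"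
  proof (induction n)
    case (Suc n)
    have "a * (of_nat n * a ^ (n - 1)) = of_nat n * a ^ n"
      by (cases n) (simp_all add: mult_ac)
    moreover have "poly.coeff ([:a, v:] ^ Suc n) 1 = a * (of_nat n * a ^ (n - 1)) * v + v * a ^ n"
      using Suc 0[of n] by (simp add: mult.assoc)
    ultimately show ?case
      by (simp add: algebra_simps)
  qed simp
qed

lemma coeff_mult_1: "poly.coeff (p * q) 1 = poly.coeff p 0 * poly.coeff q 1 + poly.coeff p 1 * poly.coeff q 0"
  by (simp add: coeff_mult)

lemma coeff_1_monomial:
  fixes a b c u v w :: "'a::comm_ring_1"
  shows "poly.coeff ([:a, u:] ^ i * [:b, v:] ^ j * [:c, w:] ^ k) 1
    = of_nat i * a ^ (i - 1) * b ^ j * c ^ k * u + a ^ i * (of_nat j * b ^ (j - 1)) * c ^ k * v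
      + a ^ i * b ^ j * (of_nat k * c ^ (k - 1)) * w"
  unfolding coeff_mult_1 coeff_mult_0 coeff_linear_power by (simp only: distrib_right distrib_left mult_ac add_ac)

text \<open>The first terms of the Taylor expansion of \<open>H(p + s (u, v, w))\<close> in \<open>s\<close>.\<close>

lemma low_coeffs_subst3:
  fixes f :: "'a::idom poly poly" and p :: "'a ^ 3" and u v w :: "'a poly"
  defines "K \<equiv> subst3 const2 f [:[:p $ 1:], u:] [:[:p $ 2:], v:] [:[:p $ 3:], w:]"
    and "H \<equiv> homogenization f"
  shows "poly.coeff K 0 = [:eval3 H p:]"
    and "poly.coeff K 1 = [:eval3 (partial_X H) p:] * u + [:eval3 (partial_Y H) p:] * v
           + [:eval3 (partial_Z H) p:] * w"
proof -
  have hom: "is_ring_hom (\<lambda>c :: 'a. [:c:])"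
    by (simp add: is_ring_hom_def one_pCons)
  note push = ring_hom_sum[OF hom] ring_hom_mult[OF hom] ring_hom_power[OF hom]
  have nat: "[:of_nat n:] = (of_nat n :: 'a poly)" for n
    by (simp add: of_nat_poly)
  show "poly.coeff K 0 = [:eval3 H p:]"
    unfolding K_def H_def subst3_def eval3_homogenization_simps push coeff_sum
    by (intro sum.cong refl) (simp add: coeff_mult_0 coeff_linear_power)
  show "poly.coeff K 1 = [:eval3 (partial_X H) p:] * u + [:eval3 (partial_Y H) p:] * v
           + [:eval3 (partial_Z H) p:] * w"
    unfolding K_def H_def subst3_def eval3_homogenization_simps push coeff_sum nat
      sum_distrib_right sum.distrib[symmetric]
  proof (intro sum.cong refl)
    fix i j
    let ?e = "poly.coeff (poly.coeff f j) i" and ?k = "curve_degree f - i - j"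
    let ?a = "[:p $ 1:]" and ?b = "[:p $ 2:]" and ?c = "[:p $ 3:]"
    have const2: "poly.coeff (const2 e * q) 1 = [:e:] * poly.coeff q 1" for e and q :: "'a poly poly"
      by simp
    show "poly.coeff (const2 ?e * ([:?a, u:] ^ i * [:?b, v:] ^ j * [:?c, w:] ^ ?k)) 1
      = [:?e:] * (of_nat i * ?a ^ (i - 1) * ?b ^ j * ?c ^ ?k) * u
        + [:?e:] * (?a ^ i * (of_nat j * ?b ^ (j - 1)) * ?c ^ ?k) * v
        + [:?e:] * (?a ^ i * ?b ^ j * (of_nat ?k * ?c ^ (?k - 1))) * w"
      unfolding const2 coeff_1_monomial by (simp only: distrib_left mult.assoc)
  qed
qed

text \<open>
  With the point \<open>p\<close> at \<open>s = 0\<close> (for \<open>K\<close>), the restriction to a line through \<open>p\<close> has at least a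
  double zero there. With \<open>p\<close> at \<open>s = \<infinity>\<close> (for \<open>K'\<close>), the double zero is a drop of the degree
  by 2.
\<close>

lemma coeffs_subst3_singular:
  fixes f :: "'a::idom poly poly" and p :: "'a ^ 3" and u v w :: "'a poly"
  assumes "singular_point_of_projective_closure f p"
  defines "K \<equiv> subst3 const2 f [:[:p $ 1:], u:] [:[:p $ 2:], v:] [:[:p $ 3:], w:]"
    and "K' \<equiv> subst3 const2 f [:u, [:p $ 1:]:] [:v, [:p $ 2:]:] [:w, [:p $ 3:]:]"
  shows "poly.coeff K 0 = 0" "poly.coeff K 1 = 0" "degree K \<le> curve_degree f" "degree K' \<le> curve_degree f - 2"
proof -
  show K: "poly.coeff K 0 = 0" "poly.coeff K 1 = 0"
    using assms(1) unfolding K_def low_coeffs_subst3 singular_point_of_projective_closure_def Let_def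
    by simp_all
  have m: "mirrored (curve_degree f) K K'"
    unfolding K_def K'_def by (rule mirrored_subst3)
  show "degree K \<le> curve_degree f"
    using m by (intro degree_le) (auto simp: mirrored_def)
  show "degree K' \<le> curve_degree f - 2"
  proof (rule degree_le, clarify)
    fix n assume "curve_degree f - 2 < n"
    hence "n > curve_degree f \<or> curve_degree f - n = 0 \<and> n \<le> curve_degree f
             \<or> curve_degree f - n = 1 \<and> n \<le> curve_degree f"
      by linarith
    thus "poly.coeff K' n = 0"
      using m K by (auto simp: mirrored_def)
  qed
qed

text \<open>
  The line of slope \<open>t\<close> through \<open>(a, b)\<close> has the points \<open>(a + s, b + t s)\<close>, and \<open>s\<^sup>2\<close> splits off from
  the restriction \<open>F\<close> of \<open>f\<close>. These lines reach all points of the curve except those on the vertical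
  line \<open>x = a\<close>, which are finitely many unless the curve contains that line.
\<close>

lemma soluble_if_affine_singular_point:
  fixes f :: "'a::{alg_closed_field, field_char_0} poly poly" and p :: "'a ^ 3"
  assumes places: "\<And>t0. place_at t0 (Pl t0)"
    and irreducible: "Factorial_Ring.irreducible f"
    and degree: "curve_degree f \<le> 6"
    and singular: "singular_point_of_projective_closure f p" and affine: "p $ 3 = 1"
  shows "soluble_by_radicals Pl (affine_curve f)"
proof -
  define a b where "a = p $ 1" and "b = p $ 2"
  define u w where "u = [:[:a:], 1:]" and "w = [:[:b:], [:0, 1:]:]"
  have u: "eval_ts t s u = a + s" and w: "eval_ts t s w = b + t * s" for t s
    by (simp_all add: u_def w_def)
  define F where "F = subst2 const2 f u w"
  have "F = subst3 const2 f [:[:p $ 1:], 1:] [:[:p $ 2:], [:0, 1:]:] [:[:p $ 3:], 0:]"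
    by (simp add: F_def u_def w_def a_def b_def affine subst3_1 flip: one_pCons)
  from coeffs_subst3_singular[OF singular, of 1 "[:0, 1:]" 0, folded this]
  have F: "poly.coeff F 0 = 0" "poly.coeff F 1 = 0" "degree F \<le> curve_degree f"
    by blast+
  obtain G1 where G1: "F = pCons 0 G1" using F(1) by (cases F) auto
  then obtain G where "G1 = pCons 0 G" using F(2) by (cases G1) auto
  with G1 have G: "F = [:0, 0, 1:] * G" by simp
  have degG: "degree G \<le> 4"
  proof (cases "G = 0")
    case False
    hence "degree F = degree G + 2" by (simp add: G1 \<open>G1 = pCons 0 G\<close>)
    thus ?thesis using F(3) degree by linarith
  qed simp
  have eval_F: "poly (poly f [:b + t * s:]) (a + s) = s ^ 2 * eval_ts t s G" for t s
    using eval_ts_subst2[where f = f and U = u and W = w and s = s and t = t]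
    by (simp add: F_def[symmetric] G subst2_id u w power2_eq_square)
  show ?thesis
  proof (cases "(\<exists>t. \<forall>s. eval_ts t s G = 0) \<or> (\<forall>y. poly (poly f [:y:]) a = 0)")
    case True
    thus ?thesis
    proof
      assume "\<exists>t. \<forall>s. eval_ts t s G = 0"
      then obtain t where t: "\<And>s. eval_ts t s G = 0" by blast
      have "poly (poly f [:(b - t * a) + t * x:]) x = 0" for x
        using eval_F[of t "x - a"] by (simp add: t algebra_simps)
      thus ?thesis by (rule soluble_if_contains_graph[OF places irreducible])
    next
      assume "\<forall>y. poly (poly f [:y:]) a = 0"
      thus ?thesis using soluble_if_contains_vertical_line[OF places irreducible] by blast
    qed
  next
    case False
    then obtain y0 where y0: "poly (poly f [:y0:]) a \<noteq> 0" by blast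
    show ?thesis
    proof (rule soluble_if_swept_out_in_degree_le_4[OF places _ degG])
      show "G dvd subst2 const2 f u w" unfolding F_def[symmetric] G by (rule dvd_triv_right)
      show "\<exists>s. eval_ts t s G \<noteq> 0" for t using False by blast
      have "\<exists>t s. eval_ts t s G = 0 \<and> Q $ 1 = eval_ts t s u \<and> Q $ 2 = eval_ts t s w"
        if Q: "Q \<in> affine_curve f" "Q $ 1 \<noteq> a" for Q :: "'a ^ 2"
      proof -
        define s t where "s = Q $ 1 - a" and "t = (Q $ 2 - b) / s"
        have s: "s \<noteq> 0" using Q(2) by (simp add: s_def)
        have Q12: "Q $ 1 = a + s" "Q $ 2 = b + t * s" using s by (auto simp: s_def t_def)
        hence "eval_ts t s G = 0"
          using Q(1) eval_F[of t s] s by (simp add: affine_curve_def eval2_def)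
        thus ?thesis using Q12 by (auto simp: u w)
      qed
      hence "{Q \<in> affine_curve f. \<not> (\<exists>t s. eval_ts t s G = 0 \<and>
          Q $ 1 = eval_ts t s u \<and> Q $ 2 = eval_ts t s w)} \<subseteq> {Q \<in> affine_curve f. Q $ 1 = a}"
        by blast
      thus "finite {Q \<in> affine_curve f. \<not> (\<exists>t s. eval_ts t s G = 0 \<and>
          Q $ 1 = eval_ts t s u \<and> Q $ 2 = eval_ts t s w)}"
        using finite_on_vertical_line[OF y0] by (rule finite_subset)
    qed
  qed
qed

text \<open>
  The lines through \<open>(a : b : 0)\<close> are the parallels of direction \<open>(a, b)\<close>. They are written as
  \<open>(0, t) + s (a, b)\<close>, or as \<open>(t, 0) + s (0, b)\<close> if the direction is vertical, and cover the plane.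
\<close>

lemma soluble_if_singular_point_at_infinity:
  fixes f :: "'a::{alg_closed_field, field_char_0} poly poly" and p :: "'a ^ 3"
  assumes places: "\<And>t0. place_at t0 (Pl t0)"
    and irreducible: "Factorial_Ring.irreducible f"
    and degree: "curve_degree f \<le> 6"
    and singular: "singular_point_of_projective_closure f p" and infinite: "p $ 3 = 0"
  shows "soluble_by_radicals Pl (affine_curve f)"
proof -
  define a b where "a = p $ 1" and "b = p $ 2"
  have ab: "a \<noteq> 0 \<or> b \<noteq> 0"
    using singular infinite
    by (auto simp: singular_point_of_projective_closure_def Let_def vec_eq_iff forall_3 a_def b_def)
  define u0 w0 :: "'a poly" where "u0 = (if a = 0 then [:0, 1:] else 0)" and "w0 = (if a = 0 then 0 else [:0, 1:])"
  define u w where "u = [:u0, [:a:]:]" and "w = [:w0, [:b:]:]"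
  have u: "eval_ts t s u = (if a = 0 then t else a * s)"
    and w: "eval_ts t s w = (if a = 0 then b * s else t + b * s)" for t s
    by (simp_all add: u_def w_def u0_def w0_def)
  define F where "F = subst2 const2 f u w"
  have "F = subst3 const2 f [:u0, [:p $ 1:]:] [:w0, [:p $ 2:]:] [:1, [:p $ 3:]:]"
    by (simp add: F_def u_def w_def a_def b_def infinite subst3_1 flip: one_pCons)
  hence degF: "degree F \<le> 4"
    using coeffs_subst3_singular(4)[OF singular, of u0 w0 1] degree by simp
  have eval_F: "eval_ts t s F = poly (poly f [:eval_ts t s w:]) (eval_ts t s u)" for t s
    using eval_ts_subst2[where f = f and U = u and W = w and s = s and t = t]
    by (simp add: F_def subst2_id)
  show ?thesis
  proof (cases "\<exists>t. \<forall>s. eval_ts t s F = 0")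
    case True
    then obtain t where t: "\<And>s. poly (poly f [:eval_ts t s w:]) (eval_ts t s u) = 0"
      unfolding eval_F by blast
    show ?thesis
    proof (cases "a = 0")
      case a: True
      have "poly (poly f [:y:]) t = 0" for y
        using t[of "y / b"] a ab by (simp add: u w)
      thus ?thesis by (rule soluble_if_contains_vertical_line[OF places irreducible])
    next
      case a: False
      have "poly (poly f [:t + (b / a) * x:]) x = 0" for x
        using t[of "x / a"] a by (simp add: u w)
      thus ?thesis by (rule soluble_if_contains_graph[OF places irreducible])
    qed
  next
    case False
    show ?thesis
    proof (rule soluble_if_swept_out_in_degree_le_4[OF places _ degF])
      show "F dvd subst2 const2 f u w" by (simp add: F_def)
      show "\<exists>s. eval_ts t s F \<noteq> 0" for t using False by blast
      have "\<exists>t s. eval_ts t s F = 0 \<and> Q $ 1 = eval_ts t s u \<and> Q $ 2 = eval_ts t s w"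
        if Q: "Q \<in> affine_curve f" for Q :: "'a ^ 2"
      proof -
        have "\<exists>t s. Q $ 1 = eval_ts t s u \<and> Q $ 2 = eval_ts t s w"
        proof (cases "a = 0")
          case True
          thus ?thesis using ab by (intro exI[of _ "Q $ 1"] exI[of _ "Q $ 2 / b"]) (simp add: u w)
        next
          case False
          thus ?thesis
            by (intro exI[of _ "Q $ 2 - b * (Q $ 1 / a)"] exI[of _ "Q $ 1 / a"]) (simp add: u w)
        qed
        then obtain t s where "Q $ 1 = eval_ts t s u" "Q $ 2 = eval_ts t s w" by blast
        moreover from this have "eval_ts t s F = 0"
          using Q by (simp add: eval_F affine_curve_def eval2_def)
        ultimately show ?thesis by blast
      qed
      hence "{Q \<in> affine_curve f. \<not> (\<exists>t s. eval_ts t s F = 0 \<and>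
          Q $ 1 = eval_ts t s u \<and> Q $ 2 = eval_ts t s w)} = {}"
        by blast
      thus "finite {Q \<in> affine_curve f. \<not> (\<exists>t s. eval_ts t s F = 0 \<and>
          Q $ 1 = eval_ts t s u \<and> Q $ 2 = eval_ts t s w)}"
        by (simp only: finite.emptyI)
    qed
  qed
qed

text \<open>A singular point off the line at infinity is normalized to have third coordinate 1.\<close>

theorem corollary3p3:
  fixes f :: "'a::{alg_closed_field, field_char_0} poly poly"
    and C :: "('a ^ 2) set"
    and Pl :: "'a \<Rightarrow> 'a ratfun_closure set"
  assumes places: "\<And>t0. place_at t0 (Pl t0)"
    and irreducible: "Factorial_Ring.irreducible f"
    and curve: "C = affine_curve f"
    and degree: "curve_degree f \<le> 6"
    and singular: "\<exists>p. singular_point_of_projective_closure f p"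
  shows "soluble_by_radicals Pl C"
proof -
  obtain p where p: "singular_point_of_projective_closure f p"
    using singular by blast
  show ?thesis
  proof (cases "p $ 3 = 0")
    case True
    thus ?thesis
      unfolding curve by (rule soluble_if_singular_point_at_infinity[OF places irreducible degree p])
  next
    case False
    hence "singular_point_of_projective_closure f (\<chi> i. inverse (p $ 3) * p $ i)"
      by (intro singular_point_scale[OF p]) simp
    from soluble_if_affine_singular_point[OF places irreducible degree this] False
    show ?thesis unfolding curve by simp
  qed
qed

end
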